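(* Let $E$ be a Banach lattice and let $X$ be a Banach space with the unconditional subsequence property (USP). A bounded linear operator $T:E\to X$ is lattice strictly singular (LSS) if and only if it is disjointly strictly singular (DSS).
   Context: For a sequence $(x_n)$ in a Banach space, $[x_n]$ denotes its closed linear span. Let $E$ be a Banach lattice, $X$ a Banach space and $T:E\to X$ a bounded linear operator. $T$ is disjointly strictly singular (DSS) if there is no infinite sequence $(x_n)_n$ of pairwise disjoint (non-zero) vectors in $E$ such that the restriction of $T$ to $[x_n]$ is an isomorphism onto its image. $T$ is lattice strictly singular (LSS) if for every infinite-dimensional closed sublattice $S\subset E$ the restriction $T|_S$ is not an isomorphism onto its image; equivalently, there is no infinite sequence $(x_n)_n$ of positive pairwise disjoint (non-zero) vectors in $E$ such that the restriction of $T$ to $[x_n]$ is an isomorphism onto its image. A Banach space $X$ has the unconditional subsequence property (USP) if every seminormalized weakly null sequence in $X$ has a subsequence which is an unconditional basic sequence. A sequence is seminormalized if its norms are bounded above and bounded away from $0$. *)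

theory Defs
  imports "HOL-Analysis.Analysis" "HOL-Library.Lattice_Algebras"
begin

section \<open>Banach lattices\<close>

text \<open>The modulus is \<open>\<bar>x\<bar> = sup x (- x)\<close>, by the class \<^class>\<open>lattice_ab_group_add_abs\<close>.\<close>

class banach_lattice = banach + ordered_real_vector + lattice_ab_group_add_abs +
  assumes norm_lattice_mono: "\<bar>x\<bar> \<le> \<bar>y\<bar> \<Longrightarrow> norm x \<le> norm y"

definition disjoint_vec :: "'a::banach_lattice \<Rightarrow> 'a \<Rightarrow> bool" where
  "disjoint_vec x y \<longleftrightarrow> inf \<bar>x\<bar> \<bar>y\<bar> = 0"

definition sublattice :: "'a::banach_lattice set \<Rightarrow> bool" where
  "sublattice S \<longleftrightarrow> subspace S \<and> (\<forall>x\<in>S. \<forall>y\<in>S. sup x y \<in> S \<and> inf x y \<in> S)"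

definition infinite_dimensional :: "'a::real_vector set \<Rightarrow> bool" where
  "infinite_dimensional S \<longleftrightarrow> (\<nexists>B. finite B \<and> span B = S)"


section \<open>Closed linear spans and isomorphisms onto the image\<close>

definition closed_span :: "(nat \<Rightarrow> 'a::real_normed_vector) \<Rightarrow> 'a set" where
  "closed_span x = closure (span (range x))"

text \<open>Only used for bounded linear \<open>T\<close> and closed subspaces \<open>S\<close>.  The inverse \<open>g\<close> is then
  automatically linear on \<open>T ` S\<close>, so it is enough to ask for a homeomorphism.\<close>

definition iso_onto_image :: "'a::real_normed_vector set \<Rightarrow> ('a \<Rightarrow> 'b::real_normed_vector) \<Rightarrow> bool" where
  "iso_onto_image S T \<longleftrightarrow> (\<exists>g. homeomorphism S (T ` S) T g)"


section \<open>Disjointly and lattice strictly singular operators\<close>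

definition DSS :: "('a::banach_lattice \<Rightarrow> 'b::banach) \<Rightarrow> bool" where
  "DSS T \<longleftrightarrow> \<not> (\<exists>x :: nat \<Rightarrow> 'a.
     (\<forall>n. x n \<noteq> 0) \<and> (\<forall>m n. m \<noteq> n \<longrightarrow> disjoint_vec (x m) (x n)) \<and>
     iso_onto_image (closed_span x) T)"

definition LSS :: "('a::banach_lattice \<Rightarrow> 'b::banach) \<Rightarrow> bool" where
  "LSS T \<longleftrightarrow> (\<forall>S. sublattice S \<and> closed S \<and> infinite_dimensional S \<longrightarrow> \<not> iso_onto_image S T)"


section \<open>Unconditional basic sequences and the unconditional subsequence property\<close>

definition basic_sequence :: "(nat \<Rightarrow> 'a::banach) \<Rightarrow> bool" where
  "basic_sequence x \<longleftrightarrow> (\<forall>v\<in>closed_span x. \<exists>!a :: nat \<Rightarrow> real. (\<lambda>n. a n *\<^sub>R x n) sums v)"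

text \<open>Convergence of the net of finite partial sums (\<^const>\<open>summable_on\<close>) is unconditional
  convergence.\<close>

definition unconditional_basic_sequence :: "(nat \<Rightarrow> 'a::banach) \<Rightarrow> bool" where
  "unconditional_basic_sequence x \<longleftrightarrow> basic_sequence x \<and>
     (\<forall>a :: nat \<Rightarrow> real. summable (\<lambda>n. a n *\<^sub>R x n) \<longrightarrow> (\<lambda>n. a n *\<^sub>R x n) summable_on UNIV)"

definition seminormalized :: "(nat \<Rightarrow> 'a::real_normed_vector) \<Rightarrow> bool" where
  "seminormalized x \<longleftrightarrow> (\<exists>c C. 0 < c \<and> (\<forall>n. c \<le> norm (x n) \<and> norm (x n) \<le> C))"

definition weakly_null :: "(nat \<Rightarrow> 'a::real_normed_vector) \<Rightarrow> bool" where
  "weakly_null x \<longleftrightarrow> (\<forall>f :: 'a \<Rightarrow> real. bounded_linear f \<longrightarrow> (\<lambda>n. f (x n)) \<longlonglongrightarrow> 0)"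

definition USP :: "'a::banach itself \<Rightarrow> bool" where
  "USP (_ :: 'a itself) \<longleftrightarrow> (\<forall>x :: nat \<Rightarrow> 'a. seminormalized x \<and> weakly_null x \<longrightarrow>
     (\<exists>r. strict_mono r \<and> unconditional_basic_sequence (x \<circ> r)))"

end

theory Submission
  imports Defs
begin

text \<open>
  One implication is lattice theory: an infinite-dimensional sublattice contains an infinite
  disjoint sequence (\<open>infinite_disjoint_sequence\<close>), so an isomorphic copy of a closed sublattice
  under \<open>T\<close> yields a disjoint sequence on whose closed span \<open>T\<close> is an isomorphism.

  For the converse let \<open>(x\<^sub>n)\<close> be a normalised disjoint sequence with \<open>\<parallel>T v\<parallel> \<ge> c \<parallel>v\<parallel>\<close> on its span; a
  \<^emph>\<open>positive\<close> disjoint sequence with such a bound is needed.  The idea is to compare \<open>x\<^sub>n\<close> with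
  \<open>x\<^sub>n\<^sup>+\<close> and \<open>x\<^sub>n\<^sup>-\<close>.  If \<open>T\<close> is small on nonnegative combinations
  \<open>\<Sum>a\<^sub>k x\<^sub>k\<^sup>+\<close> with \<open>\<parallel>\<Sum>a\<^sub>k x\<^sub>k\<parallel> = 1\<close>, then \<open>T (\<Sum>a\<^sub>k x\<^sub>k)\<close> is almost
  \<open>- T (\<Sum>a\<^sub>k x\<^sub>k\<^sup>-)\<close>, and the vectors \<open>\<Sum>a\<^sub>k x\<^sub>k\<^sup>-\<close> taken over successive blocks of indices
  form the desired sequence (\<open>not_LSS_if_small_on_positive_combinations\<close>).

  If \<open>(x\<^sub>n\<^sup>+)\<close> is weakly null, then either \<open>T x\<^sub>n\<^sup>+\<close> tends to \<open>0\<close> on a subsequence, which gives such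
  combinations, or the unconditional subsequence property makes a subsequence of \<open>(T x\<^sub>n\<^sup>+)\<close> an
  unconditional basic sequence.  In the latter case, if \<open>T\<close> is not already bounded below on the span
  of a tail of the \<open>x\<^sub>n\<^sup>+\<close>, there are combinations, with coefficients of any sign, on which it is small;
  unconditionality allows the coefficients to be replaced by their moduli
  (\<open>unconditional_blocks_abs_tendsto_zero\<close>, which needs the basis constant).

  If \<open>(x\<^sub>n\<^sup>+)\<close> is not weakly null, some functional is bounded away from \<open>0\<close> on a subsequence, and
  disjointness makes the corresponding \<open>(x\<^sub>n)\<close>, hence \<open>(T x\<^sub>n)\<close>, equivalent to the basis of
  \<open>\<ell>\<^sub>1\<close>.  By Rosenthal's \<open>\<ell>\<^sub>1\<close> theorem (\<open>rosenthal_l1\<close>), one of \<open>(T x\<^sub>n\<^sup>+)\<close>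
  and \<open>(T x\<^sub>n\<^sup>-)\<close> has a subsequence equivalent to the basis of \<open>\<ell>\<^sub>1\<close>, as otherwise their difference
  \<open>(T x\<^sub>n)\<close> would have a weakly Cauchy subsequence, against the Hahn--Banach theorem.  On the
  corresponding positive disjoint sequence \<open>T\<close> is an isomorphism.
\<close>

section \<open>Disjoint vectors and positive parts\<close>

lemma scaleR_sup:
  fixes x y :: "'a::banach_lattice"
  assumes "0 \<le> a"
  shows "a *\<^sub>R sup x y = sup (a *\<^sub>R x) (a *\<^sub>R y)"
proof (cases "a = 0")
  case False
  then have a: "a > 0" using assms by simp
  show ?thesis
  proof (rule antisym)
    have "x \<le> inverse a *\<^sub>R sup (a *\<^sub>R x) (a *\<^sub>R y)" "y \<le> inverse a *\<^sub>R sup (a *\<^sub>R x) (a *\<^sub>R y)"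
      using a scaleR_left_mono[of "a *\<^sub>R x" "sup (a *\<^sub>R x) (a *\<^sub>R y)" "inverse a"]
        scaleR_left_mono[of "a *\<^sub>R y" "sup (a *\<^sub>R x) (a *\<^sub>R y)" "inverse a"] by auto
    then have "sup x y \<le> inverse a *\<^sub>R sup (a *\<^sub>R x) (a *\<^sub>R y)" by simp
    then have "a *\<^sub>R sup x y \<le> a *\<^sub>R inverse a *\<^sub>R sup (a *\<^sub>R x) (a *\<^sub>R y)"
      using assms by (intro scaleR_left_mono) auto
    then show "a *\<^sub>R sup x y \<le> sup (a *\<^sub>R x) (a *\<^sub>R y)" using a by simp
  qed (use assms in \<open>auto intro: scaleR_left_mono\<close>)
qed auto

lemma pprt_scaleR:
  fixes x :: "'a::banach_lattice"
  shows "0 \<le> a \<Longrightarrow> pprt (a *\<^sub>R x) = a *\<^sub>R pprt x"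
  by (simp add: pprt_def scaleR_sup)

lemma abs_scaleR:
  fixes x :: "'a::banach_lattice"
  shows "\<bar>a *\<^sub>R x\<bar> = \<bar>a\<bar> *\<^sub>R \<bar>x\<bar>"
proof -
  have *: "\<bar>b *\<^sub>R x\<bar> = b *\<^sub>R \<bar>x\<bar>" if "0 \<le> b" for b :: real and x :: 'a
    using that scaleR_sup[of b x "-x"] by (simp add: abs_lattice)
  show ?thesis using *[of a x] *[of "-a" x] by (cases "0 \<le> a") (auto simp: abs_minus_cancel)
qed

lemma norm_abs_lattice [simp]:
  fixes x :: "'a::banach_lattice"
  shows "norm \<bar>x\<bar> = norm x"
  by (rule antisym; rule norm_lattice_mono) simp_all

lemma norm_mono_pos:
  fixes x :: "'a::banach_lattice"
  shows "0 \<le> x \<Longrightarrow> x \<le> y \<Longrightarrow> norm x \<le> norm y"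
  by (rule norm_lattice_mono) (metis abs_of_nonneg order_trans)

lemma pprt_le_abs:
  fixes x :: "'a::banach_lattice"
  shows "pprt x \<le> \<bar>x\<bar>"
  by (simp add: pprt_def abs_ge_self)

lemma pprt_minus_pprt_uminus:
  fixes x :: "'a::banach_lattice"
  shows "x = pprt x - pprt (- x)"
  using prts[of x] by (simp add: pprt_neg)

lemma abs_eq_pprt_add:
  fixes x :: "'a::banach_lattice"
  shows "\<bar>x\<bar> = pprt x + pprt (- x)"
  using abs_prts[of x] by (simp add: pprt_neg)

lemma pprt_disjoint:
  fixes x :: "'a::banach_lattice"
  shows "inf (pprt x) (pprt (- x)) = 0"
proof -
  have "inf (pprt x) (pprt (- x)) = pprt (-x) + inf (pprt x - pprt (- x)) 0"
    using add_inf_distrib_left[of "pprt (-x)" "pprt x - pprt (- x)" 0] by (simp add: algebra_simps)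
  also have "\<dots> = pprt (-x) + nprt x"
    using pprt_minus_pprt_uminus[of x] by (simp add: nprt_def)
  finally show ?thesis by (simp add: pprt_neg)
qed

lemma pprt_diff_disjoint:
  fixes p q :: "'a::banach_lattice"
  assumes "inf p q = 0"
  shows "pprt (p - q) = p"
proof -
  have "pprt (p - q) = sup p q - q"
    using add_sup_distrib_right[of p q "-q"] by (simp add: pprt_def)
  then show ?thesis using assms add_eq_inf_sup[of p q] by (metis add.right_neutral add_diff_cancel_right')
qed

text \<open>If \<open>z = inf p (q + r)\<close>, then \<open>z - q\<close> lies below both \<open>p\<close> and \<open>r\<close>, so \<open>z \<le> q\<close>.\<close>

lemma inf_zero_add:
  fixes p q r :: "'a::banach_lattice"
  assumes "inf p q = 0" "inf p r = 0"
  shows "inf p (q + r) = 0"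
proof (rule antisym)
  have pos: "0 \<le> p" "0 \<le> q" "0 \<le> r"
    using assms by (metis inf.cobounded1 inf.cobounded2)+
  let ?z = "inf p (q + r)"
  have "?z - q \<le> r" by (simp add: algebra_simps diff_le_eq)
  moreover have "?z - q \<le> p"
    using pos(2) by (meson diff_le_eq inf.cobounded1 le_add_same_cancel1 order_trans)
  ultimately have "?z - q \<le> inf p r" by simp
  then have "?z \<le> q" using assms by simp
  moreover have "?z \<le> p" by simp
  ultimately have "?z \<le> inf p q" by (intro le_infI)
  then show "?z \<le> 0" using assms(1) by simp
  show "0 \<le> ?z" using pos by simp
qed

lemma inf_zero_mono:
  fixes p q :: "'a::banach_lattice"
  assumes "inf p q = 0" "0 \<le> p'" "p' \<le> p" "0 \<le> q'" "q' \<le> q"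
  shows "inf p' q' = 0"
proof (rule antisym)
  show "inf p' q' \<le> 0" using assms inf_mono[of p' p q' q] by simp
qed (use assms in auto)

lemma inf_zero_scaleR:
  fixes p q :: "'a::banach_lattice"
  assumes "inf p q = 0" "0 \<le> a"
  shows "inf (a *\<^sub>R p) q = 0"
proof -
  have pos: "0 \<le> p" "0 \<le> q" using assms by (metis inf.cobounded1 inf.cobounded2)+
  have "inf (real n *\<^sub>R p) q = 0" for n
    using pos assms inf_zero_add[of q "real n *\<^sub>R p" p for n]
    by (induction n) (auto simp: algebra_simps inf_commute intro: inf_absorb1)
  moreover obtain n where "a \<le> real n" using real_arch_simple by blast
  ultimately show ?thesis
    using pos assms scaleR_right_mono[of a "real n" p]
    by (intro inf_zero_mono[of "real n *\<^sub>R p" q "a *\<^sub>R p" q]) (simp_all add: scaleR_nonneg_nonneg)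
qed

lemma disjoint_vec_commute: "disjoint_vec x y \<Longrightarrow> disjoint_vec y x"
  by (simp add: disjoint_vec_def inf_commute)

lemma disjoint_vec_pos: "0 \<le> x \<Longrightarrow> 0 \<le> y \<Longrightarrow> disjoint_vec x y \<longleftrightarrow> inf x y = 0"
  by (simp add: disjoint_vec_def)

lemma disjoint_vec_mono:
  "disjoint_vec x y \<Longrightarrow> \<bar>x'\<bar> \<le> \<bar>x\<bar> \<Longrightarrow> \<bar>y'\<bar> \<le> \<bar>y\<bar> \<Longrightarrow> disjoint_vec x' y'"
  unfolding disjoint_vec_def by (rule inf_zero_mono) auto

lemma disjoint_vec_add: "disjoint_vec x y \<Longrightarrow> disjoint_vec x z \<Longrightarrow> disjoint_vec x (y + z)"
  unfolding disjoint_vec_def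
  using inf_zero_add[of "\<bar>x\<bar>" "\<bar>y\<bar>" "\<bar>z\<bar>"] inf_zero_mono[of "\<bar>x\<bar>" "\<bar>y\<bar> + \<bar>z\<bar>" "\<bar>x\<bar>" "\<bar>y + z\<bar>"]
  by (simp add: abs_triangle_ineq)

lemma disjoint_vec_scaleR: "disjoint_vec x y \<Longrightarrow> disjoint_vec (a *\<^sub>R x) y"
  unfolding disjoint_vec_def abs_scaleR by (rule inf_zero_scaleR) auto

lemma disjoint_vec_zero [simp]: "disjoint_vec x 0"
  by (simp add: disjoint_vec_def inf_absorb2)

lemma disjoint_vec_sum:
  "(\<And>k. k \<in> F \<Longrightarrow> disjoint_vec x (y k)) \<Longrightarrow> disjoint_vec x (sum y F)"
  by (induction F rule: infinite_finite_induct) (auto intro: disjoint_vec_add)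

lemma abs_pprt_le: "\<bar>pprt x\<bar> \<le> \<bar>x::'a::banach_lattice\<bar>"
  using pprt_le_abs[of x] by (simp add: abs_of_nonneg)

text \<open>The vectors \<open>x\<^sup>+ + y\<^sup>+\<close> and \<open>x\<^sup>- + y\<^sup>-\<close> are positive, disjoint, and have difference \<open>x + y\<close>; a
  decomposition of this kind determines the positive part (\<open>pprt_diff_disjoint\<close>).\<close>

lemma pprt_add_disjoint:
  assumes "disjoint_vec x y"
  shows "pprt (x + y) = pprt x + pprt y"
proof -
  have d: "disjoint_vec (pprt x) (pprt (-y))" "disjoint_vec (pprt y) (pprt (-x))"
    using disjoint_vec_mono[OF assms] disjoint_vec_mono[OF disjoint_vec_commute[OF assms]]
      abs_pprt_le[of x] abs_pprt_le[of "-x"] abs_pprt_le[of y] abs_pprt_le[of "-y"]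
    by (auto simp: abs_minus_cancel)
  have "inf (pprt (-x)) (pprt x + pprt y) = 0" "inf (pprt (-y)) (pprt x + pprt y) = 0"
    using d by (auto intro!: inf_zero_add simp: disjoint_vec_pos pprt_disjoint inf_commute)
  then have "inf (pprt x + pprt y) (pprt (-x) + pprt (-y)) = 0"
    by (intro inf_zero_add) (auto simp: inf_commute)
  from pprt_diff_disjoint[OF this] show ?thesis
    using pprt_minus_pprt_uminus[of x] pprt_minus_pprt_uminus[of y]
    by (metis add_diff_add)
qed

lemma pprt_sum_disjoint:
  assumes "finite F" "\<And>j k. j \<in> F \<Longrightarrow> k \<in> F \<Longrightarrow> j \<noteq> k \<Longrightarrow> disjoint_vec (x j) (x k)"
  shows "pprt (sum x F) = (\<Sum>k\<in>F. pprt (x k))"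
  using assms
proof (induction F rule: finite_induct)
  case (insert j F)
  have "disjoint_vec (x j) (sum x F)"
    by (rule disjoint_vec_sum) (use insert in \<open>metis insert_iff\<close>)
  then show ?case using insert by (simp add: pprt_add_disjoint)
qed simp

text \<open>This is what makes disjoint sequences unconditional: the norm of a combination depends only on
  the moduli of its terms, so signs may be changed and each vector replaced by its modulus.\<close>

lemma abs_sum_disjoint:
  assumes "finite F" "\<And>j k. j \<in> F \<Longrightarrow> k \<in> F \<Longrightarrow> j \<noteq> k \<Longrightarrow> disjoint_vec (x j) (x k)"
  shows "\<bar>sum x F\<bar> = (\<Sum>k\<in>F. \<bar>x k\<bar>)"
proof -
  have "disjoint_vec (- x j) (- x k)" if "j \<in> F" "k \<in> F" "j \<noteq> k" for j k
    using assms(2)[OF that] by (simp add: disjoint_vec_def)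
  then have "pprt (- sum x F) = (\<Sum>k\<in>F. pprt (- x k))"
    using pprt_sum_disjoint[of F "\<lambda>k. - x k"] assms by (simp add: sum_negf)
  then show ?thesis
    using pprt_sum_disjoint[OF assms] by (simp add: abs_eq_pprt_add sum.distrib)
qed

section \<open>Closed spans of disjoint positive sequences\<close>

text \<open>Through the monotonicity of the norm, this makes taking positive parts a contraction; hence the
  closure of a sublattice is again a sublattice.\<close>

lemma abs_pprt_diff_le:
  fixes x y :: "'a::banach_lattice"
  shows "\<bar>pprt x - pprt y\<bar> \<le> \<bar>x - y\<bar>"
proof -
  have *: "pprt x - pprt y \<le> \<bar>x - y\<bar>" for x y :: 'a
  proof -
    have "x \<le> pprt y + \<bar>x - y\<bar>"
      by (metis abs_ge_self add_mono diff_add_cancel add.commute le_sup_iff pprt_def order_refl)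
    moreover have "0 \<le> pprt y + \<bar>x - y\<bar>" by simp
    ultimately have "pprt x \<le> \<bar>x - y\<bar> + pprt y"
      unfolding pprt_def[of x] by (simp add: add.commute)
    then show ?thesis by (simp only: diff_le_eq)
  qed
  show ?thesis using *[of x y] *[of y x]
    by (simp add: abs_le_iff abs_minus_commute)
qed

lemma continuous_on_pprt: "continuous_on (S :: 'a::banach_lattice set) pprt"
proof (rule continuous_onI)
  fix x :: 'a and e :: real assume "0 < e"
  have "dist (pprt x') (pprt x) \<le> dist x' x" for x' :: 'a
    unfolding dist_norm by (rule norm_lattice_mono[OF abs_pprt_diff_le])
  then show "\<exists>d>0. \<forall>x'\<in>S. dist x' x < d \<longrightarrow> dist (pprt x') (pprt x) \<le> e"
    using \<open>0 < e\<close> by (meson less_le_trans order.trans order.strict_implies_order)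
qed

lemma subspace_closure:
  fixes S :: "'a::real_normed_vector set"
  assumes "subspace S"
  shows "subspace (closure S)"
proof (rule subspaceI)
  show "0 \<in> closure S" using assms closure_subset subspace_0 by blast
next
  fix x y assume "x \<in> closure S" "y \<in> closure S"
  then obtain f g where "\<And>n. f n \<in> S" "f \<longlonglongrightarrow> x" "\<And>n. g n \<in> S" "g \<longlonglongrightarrow> y"
    unfolding closure_sequential by blast
  then show "x + y \<in> closure S"
    unfolding closure_sequential using assms
    by (intro exI[of _ "\<lambda>n. f n + g n"]) (auto intro: subspace_add tendsto_add)
next
  fix c x assume "x \<in> closure S"
  then obtain f where "\<And>n. f n \<in> S" "f \<longlonglongrightarrow> x"
    unfolding closure_sequential by blast
  then show "c *\<^sub>R x \<in> closure S"
    unfolding closure_sequential using assms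
    by (intro exI[of _ "\<lambda>n. c *\<^sub>R f n"]) (auto intro: subspace_scale tendsto_intros)
qed

lemma sublattice_if_pprt:
  assumes "subspace S" "\<And>x. x \<in> S \<Longrightarrow> pprt x \<in> S"
  shows "sublattice S"
proof -
  have s: "sup x y \<in> S" if "x \<in> S" "y \<in> S" for x y
  proof -
    have "sup x y = y + pprt (x - y)"
      using add_sup_distrib_left[of y "x - y" 0] by (simp add: pprt_def)
    then show ?thesis using assms that by (simp add: subspace_add subspace_diff)
  qed
  moreover have "inf x y = x + y - sup x y" for x y :: 'a
    using add_eq_inf_sup[of x y] by (metis add_diff_cancel_left')
  ultimately have "inf x y \<in> S" if "x \<in> S" "y \<in> S" for x y
    using that assms(1) by (metis subspace_add subspace_diff)
  then show ?thesis using s assms(1) by (simp add: sublattice_def)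
qed

lemma sublattice_closure:
  assumes "sublattice S"
  shows "sublattice (closure S)"
proof (rule sublattice_if_pprt)
  have sub: "subspace S" and "\<And>x. x \<in> S \<Longrightarrow> pprt x \<in> S"
    using assms by (auto simp: sublattice_def pprt_def subspace_0)
  then have "pprt ` S \<subseteq> closure S" using closure_subset by blast
  then have "pprt ` closure S \<subseteq> closure S"
    by (intro image_closure_subset continuous_on_pprt) auto
  then show "pprt x \<in> closure S" if "x \<in> closure S" for x using that by blast
  show "subspace (closure S)" using sub by (rule subspace_closure)
qed

lemma span_range_nat:
  fixes x :: "nat \<Rightarrow> 'a::real_vector"
  assumes "v \<in> span (range x)"
  obtains a n where "v = (\<Sum>k<n. a k *\<^sub>R x k)"
proof -
  have "\<exists>a n. v = (\<Sum>k<(n::nat). a k *\<^sub>R x k)"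
    using assms
  proof (induction rule: span_induct_alt)
    case base
    show ?case by (rule exI[of _ "\<lambda>_. 0"], rule exI[of _ 0]) simp
  next
    case (step c y w)
    then obtain a n j where w: "w = (\<Sum>k<n. a k *\<^sub>R x k)" and y: "y = x j" by auto
    define m where "m = max n (Suc j)"
    define b where "b = (\<lambda>k. if k < n then a k else 0)"
    have "w = (\<Sum>k<m. b k *\<^sub>R x k)"
      unfolding w by (rule sum.mono_neutral_cong_left) (auto simp: m_def b_def)
    moreover have "c *\<^sub>R y = (\<Sum>k<m. (if k = j then c else 0) *\<^sub>R x k)"
      using sum.remove[of "{..<m}" j "\<lambda>k. (if k = j then c else 0) *\<^sub>R x k"] by (simp add: y m_def)
    ultimately have "c *\<^sub>R y + w = (\<Sum>k<m. ((if k = j then c else 0) + b k) *\<^sub>R x k)"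
      by (simp add: sum.distrib scaleR_left_distrib)
    then show ?case by (rule_tac exI)+
  qed
  then show thesis using that by blast
qed

text \<open>Forming the positive part of a disjoint combination truncates each coefficient at \<open>0\<close>.\<close>

lemma sublattice_closed_span:
  assumes "\<And>n. 0 \<le> y n" "\<And>m n. m \<noteq> n \<Longrightarrow> disjoint_vec (y m) (y n)"
  shows "sublattice (closed_span y)"
  unfolding closed_span_def
proof (rule sublattice_closure, rule sublattice_if_pprt)
  fix v assume "v \<in> span (range y)"
  then obtain a n where v: "v = (\<Sum>k<n. a k *\<^sub>R y k)" by (rule span_range_nat)
  have "pprt v = (\<Sum>k<n. pprt (a k *\<^sub>R y k))"
    unfolding v by (rule pprt_sum_disjoint)
      (auto intro!: disjoint_vec_scaleR disjoint_vec_commute[OF disjoint_vec_scaleR] assms)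
  moreover have "pprt (a k *\<^sub>R y k) = max (a k) 0 *\<^sub>R y k" for k
    using assms(1)[of k]
    by (cases "0 \<le> a k") (auto simp: pprt_scaleR pprt_eq_id pprt_eq_0 scaleR_nonpos_nonneg)
  ultimately show "pprt v \<in> span (range y)" by (auto intro!: span_sum span_scale intro: span_base)
qed auto

section \<open>Disjoint sequences in infinite-dimensional sublattices\<close>

text \<open>Atomicity is relative to \<open>S\<close>: splittings of \<open>a\<close> into disjoint pieces outside \<open>S\<close> are allowed.
  Such elements are the obstacle to producing disjoint sequences by repeated splitting.\<close>

definition atom_of :: "'a::banach_lattice set \<Rightarrow> 'a \<Rightarrow> bool" where
  "atom_of S a \<longleftrightarrow> a \<in> S \<and> 0 \<le> a \<and> a \<noteq> 0 \<and>
     (\<forall>y\<in>S. \<forall>z\<in>S. 0 \<le> y \<and> y \<le> a \<and> 0 \<le> z \<and> z \<le> a \<and> inf y z = 0 \<longrightarrow> y = 0 \<or> z = 0)"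

lemma sublattice_ops:
  assumes "sublattice S" "x \<in> S"
  shows "pprt x \<in> S" "c *\<^sub>R x \<in> S" "y \<in> S \<Longrightarrow> inf x y \<in> S" "y \<in> S \<Longrightarrow> x - y \<in> S"
  using assms by (auto simp: sublattice_def pprt_def subspace_0 subspace_scale subspace_diff)

text \<open>Let \<open>l\<close> be the largest number with \<open>l a \<le> b\<close>.  For \<open>t > l\<close> the vectors \<open>(b - t a)\<^sup>+\<close> and
  \<open>t\<^sup>-\<^sup>1 (t a - b)\<^sup>+\<close> are disjoint and below the atom \<open>a\<close>.  The second is nonzero, so the first
  vanishes and \<open>b \<le> t a\<close>.\<close>

lemma atom_dominates_multiples:
  assumes S: "sublattice S" and a: "atom_of S a" and b: "b \<in> S" "0 \<le> b" "b \<le> a"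
  obtains l where "0 \<le> l" "b = l *\<^sub>R a"
proof -
  have a0: "a \<in> S" "0 \<le> a" "a \<noteq> 0" using a by (auto simp: atom_of_def)
  define L where "L = {t. t *\<^sub>R a \<le> b}"
  have bdd: "t \<le> 1" if "t \<in> L" for t
  proof (rule ccontr)
    assume "\<not> t \<le> 1"
    moreover have "(t - 1) *\<^sub>R a \<le> 0"
      using that b(3) unfolding L_def by (auto simp: scaleR_left_diff_distrib intro: order_trans)
    ultimately have "a \<le> 0" using scaleR_left_mono[of "(t - 1) *\<^sub>R a" 0 "inverse (t - 1)"] by simp
    then show False using a0 by auto
  qed
  have L0: "0 \<in> L" using b by (simp add: L_def)
  have bddL: "bdd_above L" using bdd by (rule bdd_aboveI)
  define l where "l = Sup L"
  have l0: "0 \<le> l" unfolding l_def by (rule cSup_upper[OF L0 bddL])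
  have upper: "b \<le> t *\<^sub>R a" if "l < t" for t
  proof -
    define p where "p = pprt (b - t *\<^sub>R a)"
    define q where "q = inverse t *\<^sub>R pprt (- (b - t *\<^sub>R a))"
    have t: "0 < t" using l0 that by simp
    have "t \<notin> L" using that cSup_upper[OF _ bddL] unfolding l_def by force
    then have "q \<noteq> 0" using t le_zero_iff_zero_pprt[of "t *\<^sub>R a - b"] by (auto simp: q_def L_def)
    moreover have "p \<in> S" "q \<in> S" "0 \<le> p" "0 \<le> q"
      using S a0 b t sublattice_ops[OF S] sublattice_ops(2)[OF S, of _ "-1"]
      by (auto simp: p_def q_def scaleR_nonneg_nonneg)
    moreover have "p \<le> a"
    proof -
      have "b - t *\<^sub>R a \<le> b" using scaleR_nonneg_nonneg[OF less_imp_le[OF t] a0(2)] by simp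
      then have "p \<le> b" using b by (simp add: p_def pprt_def)
      then show ?thesis using b by simp
    qed
    moreover have "q \<le> a"
    proof -
      have "- (b - t *\<^sub>R a) \<le> t *\<^sub>R a" using b by simp
      then have "pprt (- (b - t *\<^sub>R a)) \<le> t *\<^sub>R a" using scaleR_nonneg_nonneg[OF less_imp_le[OF t] a0(2)] unfolding pprt_def by simp
      from scaleR_left_mono[OF this, of "inverse t"] show ?thesis using t by (simp add: q_def)
    qed
    moreover have "inf p q = 0"
      unfolding p_def q_def using t inf_zero_scaleR[OF pprt_disjoint[of "-(b - t *\<^sub>R a)"], of "inverse t"]
      by (simp add: inf_commute)
    ultimately have "p = 0" using a by (auto simp: atom_of_def)
    then show ?thesis using le_zero_iff_zero_pprt[of "b - t *\<^sub>R a"] by (simp add: p_def)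
  qed
  have "norm (b - l *\<^sub>R a) \<le> e * norm a" if e: "e > 0" for e
  proof -
    obtain s where s: "s \<in> L" "l - e < s"
      using e less_cSup_iff[of L "l - e"] L0 bddL unfolding l_def by auto
    have "b - l *\<^sub>R a \<le> e *\<^sub>R a"
      using upper[of "l + e"] e by (simp add: algebra_simps)
    moreover have "l *\<^sub>R a - b \<le> e *\<^sub>R a"
    proof -
      have "(l - e) *\<^sub>R a \<le> s *\<^sub>R a" using s a0 by (intro scaleR_right_mono) auto
      also have "\<dots> \<le> b" using s by (simp add: L_def)
      finally show ?thesis by (simp add: algebra_simps)
    qed
    ultimately have "\<bar>b - l *\<^sub>R a\<bar> \<le> \<bar>e *\<^sub>R a\<bar>"
      using e a0 by (simp add: abs_le_iff abs_scaleR)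
    from norm_lattice_mono[OF this] show ?thesis using e by simp
  qed
  note small = this
  have "norm (b - l *\<^sub>R a) \<le> 0 + e" if "e > 0" for e
    using small[of "e / norm a"] a0 that by simp
  then have "norm (b - l *\<^sub>R a) \<le> 0" by (rule field_le_epsilon)
  then show thesis using that l0 by simp
qed

text \<open>An atom can be split off: for large \<open>m\<close> the infimum of \<open>x\<close> and \<open>m a\<close> is a multiple \<open>l a\<close> with
  \<open>l < m\<close>, so nothing below \<open>a\<close> is left in \<open>x - l a\<close>.\<close>

lemma atom_remainder:
  assumes S: "sublattice S" and a: "atom_of S a" and x: "x \<in> S" "0 \<le> x"
  obtains l where "0 \<le> l" "l *\<^sub>R a \<le> x" "inf (x - l *\<^sub>R a) a = 0"
proof -
  have a0: "a \<in> S" "0 \<le> a" "a \<noteq> 0" using a by (auto simp: atom_of_def)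
  \<comment> \<open>with this choice, \<open>m a\<close> has larger norm than \<open>x\<close>\<close>
  define m where "m = norm x / norm a + 1"
  have m: "m > 0" by (simp add: m_def add_nonneg_pos)
  have "inf (inverse m *\<^sub>R x) a \<in> S" "0 \<le> inf (inverse m *\<^sub>R x) a" "inf (inverse m *\<^sub>R x) a \<le> a"
    using sublattice_ops[OF S] a0 x m by (auto simp: scaleR_nonneg_nonneg)
  from atom_dominates_multiples[OF S a this] obtain k
    where k: "0 \<le> k" "inf (inverse m *\<^sub>R x) a = k *\<^sub>R a" .
  have kx: "(m * k) *\<^sub>R a \<le> x"
  proof -
    have "k *\<^sub>R a \<le> inverse m *\<^sub>R x" by (metis k(2) inf.cobounded1)
    from scaleR_left_mono[OF this, of m] show ?thesis using m by simp
  qed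
  have "m * k * norm a \<le> norm x"
    using norm_mono_pos[OF _ kx] k m a0 by (simp add: scaleR_nonneg_nonneg)
  also have "norm x < m * norm a" using a0 by (simp add: m_def field_simps)
  finally have k1: "k < 1" using m a0 by simp
  have "inf (inverse m *\<^sub>R x - k *\<^sub>R a) ((1 - k) *\<^sub>R a) = 0"
    using k add_inf_distrib_left[of "- (k *\<^sub>R a)" "inverse m *\<^sub>R x" a] by (simp add: scaleR_left_diff_distrib)
  from inf_zero_scaleR[OF this, of m]
  have "inf (x - (m * k) *\<^sub>R a) ((1 - k) *\<^sub>R a) = 0"
    using m by (simp add: scaleR_right_diff_distrib)
  then have "inf ((1 - k) *\<^sub>R a) (x - (m * k) *\<^sub>R a) = 0" by (simp add: inf_commute)
  from inf_zero_scaleR[OF this, of "inverse (1 - k)"]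
  have "inf (x - (m * k) *\<^sub>R a) a = 0" using k1 by (simp add: inf_commute)
  then show thesis using that[of "m * k"] kx k m by simp
qed

lemma atoms_remainder:
  assumes S: "sublattice S" and F: "finite F" "\<And>a. a \<in> F \<Longrightarrow> atom_of S a" and x: "x \<in> S" "0 \<le> x"
  shows "\<exists>y\<in>S. 0 \<le> y \<and> y \<le> x \<and> x - y \<in> span F \<and> (\<forall>a\<in>F. inf y a = 0)"
  using F
proof (induction F rule: finite_induct)
  case empty
  then show ?case using x by (auto intro!: bexI[of _ x])
next
  case (insert a F)
  then obtain y where y: "y \<in> S" "0 \<le> y" "y \<le> x" "x - y \<in> span F" "\<forall>b\<in>F. inf y b = 0" by auto
  obtain l where l: "0 \<le> l" "l *\<^sub>R a \<le> y" "inf (y - l *\<^sub>R a) a = 0"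
    using atom_remainder[OF S _ y(1,2), of a] insert.prems by auto
  have a: "a \<in> S" "0 \<le> a" using insert.prems by (auto simp: atom_of_def)
  let ?y = "y - l *\<^sub>R a"
  have "?y \<in> S" using S y a by (intro sublattice_ops) auto
  moreover have le: "0 \<le> ?y" "?y \<le> y" using l a by (auto simp: scaleR_nonneg_nonneg)
  moreover have "x - ?y \<in> span (insert a F)"
  proof -
    have "(x - y) + l *\<^sub>R a \<in> span (insert a F)"
      using y(4) span_mono[of F "insert a F"] by (intro span_add span_scale) (auto intro: span_base)
    then show ?thesis by (simp add: algebra_simps)
  qed
  moreover have "inf ?y b = 0" if "b \<in> F" for b
    using inf_zero_mono[of y b ?y b] y that le insert.prems by (auto simp: atom_of_def)
  moreover have "?y \<le> x" using le(2) y(3) by (rule order_trans)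
  ultimately show ?case using l by (intro bexI[of _ ?y]) auto
qed

text \<open>Split \<open>x\<close> into two disjoint pieces, keep one and split the other, and repeat; this never stops
  because no atom occurs.\<close>

lemma disjoint_sequence_below:
  assumes x: "x \<in> S" "0 \<le> x" "x \<noteq> 0" and na: "\<And>a. a \<le> x \<Longrightarrow> \<not> atom_of S a"
  shows "\<exists>y :: nat \<Rightarrow> 'a::banach_lattice. (\<forall>n. y n \<in> S \<and> 0 \<le> y n \<and> y n \<noteq> 0) \<and> (\<forall>m n. m < n \<longrightarrow> inf (y m) (y n) = 0)"
proof -
  have "\<exists>z :: nat \<Rightarrow> 'a. \<forall>n. (z n \<in> S \<and> 0 \<le> z n \<and> z n \<noteq> 0 \<and> z n \<le> x) \<and>
     (z (Suc n) \<le> z n \<and> (\<exists>y\<in>S. 0 \<le> y \<and> y \<noteq> 0 \<and> y \<le> z n \<and> inf y (z (Suc n)) = 0))"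
  proof (rule dependent_nat_choice)
    fix z assume "z \<in> S \<and> 0 \<le> z \<and> z \<noteq> 0 \<and> z \<le> x"
    then show "\<exists>z'. (z' \<in> S \<and> 0 \<le> z' \<and> z' \<noteq> 0 \<and> z' \<le> x) \<and> z' \<le> z \<and>
        (\<exists>y\<in>S. 0 \<le> y \<and> y \<noteq> 0 \<and> y \<le> z \<and> inf y z' = 0)"
      using na[of z] unfolding atom_of_def by (metis order_trans)
  qed (use x in auto)
  then obtain z where z: "\<And>n. z (Suc n) \<le> z n"
    and "\<And>n. \<exists>y. y \<in> S \<and> 0 \<le> y \<and> y \<noteq> 0 \<and> y \<le> z n \<and> inf y (z (Suc n)) = 0" by blast
  then obtain y where y: "\<And>n. y n \<in> S \<and> 0 \<le> y n \<and> y n \<noteq> 0 \<and> y n \<le> z n \<and> inf (y n) (z (Suc n)) = 0"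
    by metis
  have "inf (y m) (y n) = 0" if "m < n" for m n
  proof -
    have "z n \<le> z (Suc m)" using that by (intro lift_Suc_antimono_le[of z, OF z]) simp
    then have "y n \<le> z (Suc m)" using y[of n] by (blast intro: order_trans)
    then show ?thesis using y[of m] y[of n] by (intro inf_zero_mono[of "y m" "z (Suc m)" "y m" "y n"]) simp_all
  qed
  then show ?thesis using y by blast
qed

text \<open>If some positive element of \<open>S\<close> has no atom below it, it can be split forever.  Otherwise take
  finitely many disjoint atoms.  They do not span \<open>S\<close>, so some positive vector leaves a nonzero
  remainder after they have been split off, and an atom below this remainder extends the family.\<close>

theorem infinite_disjoint_sequence:
  fixes S :: "'a::banach_lattice set"
  assumes S: "sublattice S" and inf: "infinite_dimensional S"
  shows "\<exists>y :: nat \<Rightarrow> 'a. (\<forall>n. y n \<in> S \<and> 0 \<le> y n \<and> y n \<noteq> 0) \<and>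
    (\<forall>m n. m \<noteq> n \<longrightarrow> disjoint_vec (y m) (y n))"
proof -
  have "\<exists>y :: nat \<Rightarrow> 'a. (\<forall>n. y n \<in> S \<and> 0 \<le> y n \<and> y n \<noteq> 0) \<and> (\<forall>m n. m < n \<longrightarrow> inf (y m) (y n) = 0)"
  proof (cases "\<exists>x\<in>S. 0 \<le> x \<and> x \<noteq> 0 \<and> (\<forall>a\<le>x. \<not> atom_of S a)")
    case True
    then show ?thesis using disjoint_sequence_below by blast
  next
    case False
    have ext: "\<exists>a. atom_of S a \<and> (\<forall>b\<in>F. inf b a = 0)"
      if F: "finite F" "\<And>a. a \<in> F \<Longrightarrow> atom_of S a" for F
    proof -
      have "F \<subseteq> S" using F by (auto simp: atom_of_def)
      then have "span F \<subseteq> S" using S by (intro span_minimal) (auto simp: sublattice_def)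
      then obtain v where v: "v \<in> S" "v \<notin> span F" using inf F(1) by (auto simp: infinite_dimensional_def)
      have "pprt v \<notin> span F \<or> pprt (-v) \<notin> span F"
        using v(2) pprt_minus_pprt_uminus[of v] by (metis span_diff)
      then obtain x where x: "x \<in> S" "0 \<le> x" "x \<notin> span F"
        using sublattice_ops(1)[OF S] v(1) sublattice_ops(2)[OF S v(1), of "-1"] by (metis scaleR_minus1_left zero_le_pprt)
      obtain y where y: "y \<in> S" "0 \<le> y" "x - y \<in> span F" "\<forall>a\<in>F. inf y a = 0"
        using atoms_remainder[OF S F x(1,2)] by blast
      then have "y \<noteq> 0" using x by auto
      then obtain a where a: "a \<le> y" "atom_of S a" using False y by blast
      then have "inf b a = 0" if "b \<in> F" for b
        using inf_zero_mono[of y b a b] y that F(2)[OF that] by (auto simp: atom_of_def inf_commute)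
      then show ?thesis using a by blast
    qed
    have "\<exists>f :: nat \<Rightarrow> 'a. \<forall>n. atom_of S (f n) \<and> (\<forall>m<n. inf (f m) (f n) = 0)"
    proof (rule dependent_wf_choice[OF wf_less_than, where P = "\<lambda>f n r. atom_of S r \<and> (\<forall>m<n. inf (f m) r = 0)"])
      fix n :: nat and f assume *: "\<And>m. (m, n) \<in> less_than \<Longrightarrow> atom_of S (f m) \<and> (\<forall>k<m. inf (f k) (f m) = 0)"
      show "\<exists>r. atom_of S r \<and> (\<forall>m<n. inf (f m) r = 0)"
        using ext[of "f ` {..<n}"] * by (metis finite_imageI finite_lessThan imageE image_eqI lessThan_iff less_than_iff)
    qed auto
    then obtain f :: "nat \<Rightarrow> 'a" where "\<forall>n. atom_of S (f n) \<and> (\<forall>m<n. inf (f m) (f n) = 0)" ..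
    then show ?thesis by (intro exI[of _ f]) (simp add: atom_of_def)
  qed
  then obtain y :: "nat \<Rightarrow> 'a" where y: "\<And>n. y n \<in> S \<and> 0 \<le> y n \<and> y n \<noteq> 0"
    "\<And>m n. m < n \<Longrightarrow> inf (y m) (y n) = 0" by blast
  have "disjoint_vec (y m) (y n)" if "m \<noteq> n" for m n
    using y(1)[of m] y(1)[of n] y(2)[of m n] y(2)[of n m] that
    by (cases "m < n") (auto simp: disjoint_vec_pos inf_commute)
  then show ?thesis using y(1) by blast
qed

section \<open>Isomorphisms onto the image as lower bounds\<close>

text \<open>The inverse is continuous at \<open>0\<close>, so it is bounded near \<open>0\<close>; rescaling gives the bound.\<close>

lemma iso_onto_image_lower_bound:
  assumes T: "bounded_linear T" and S: "subspace S" and iso: "iso_onto_image S T"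
  obtains c where "c > 0" "\<And>v. v \<in> S \<Longrightarrow> c * norm v \<le> norm (T v)"
proof -
  interpret bounded_linear T by fact
  obtain g where g: "homeomorphism S (T ` S) T g" using iso by (auto simp: iso_onto_image_def)
  have g_inv: "\<And>v. v \<in> S \<Longrightarrow> g (T v) = v" and cont: "continuous_on (T ` S) g"
    using g by (auto simp: homeomorphism_def)
  have 0: "0 \<in> T ` S" "g 0 = 0" using subspace_0[OF S] g_inv[of 0] zero by (auto intro: rev_image_eqI)
  obtain d where d: "d > 0" "\<And>w. w \<in> T ` S \<Longrightarrow> norm w < d \<Longrightarrow> norm (g w) < 1"
    using continuous_on_iff[THEN iffD1, OF cont, rule_format, OF 0(1) zero_less_one] 0(2)
    by (auto simp: dist_norm)
  have "d * norm v \<le> norm (T v)" if v: "v \<in> S" for v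
  proof (cases "v = 0")
    case False
    let ?v = "inverse (norm v) *\<^sub>R v"
    have "?v \<in> S" "norm ?v = 1" using v S False by (auto simp: subspace_scale)
    then have "\<not> norm (T ?v) < d" using d(2)[of "T ?v"] g_inv[of ?v] by auto
    then show ?thesis using False by (simp add: scaleR field_simps)
  qed auto
  then show thesis using that d(1) by blast
qed

lemma iso_onto_image_if_lower_bound:
  assumes T: "bounded_linear T" and S: "subspace S" and c: "c > 0" "\<And>v. v \<in> S \<Longrightarrow> c * norm v \<le> norm (T v)"
  shows "iso_onto_image S T"
proof -
  interpret bounded_linear T by fact
  have lip: "c * dist u v \<le> dist (T u) (T v)" if "u \<in> S" "v \<in> S" for u v
    using c(2)[of "u - v"] that S by (simp add: dist_norm diff subspace_diff)
  have inj: "inj_on T S"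
  proof (rule inj_onI)
    fix u v assume "u \<in> S" "v \<in> S" "T u = T v"
    then have "c * dist u v \<le> 0" using lip[of u v] by simp
    then show "u = v" using c(1) by (simp add: mult_le_0_iff)
  qed
  have "continuous_on (T ` S) (inv_into S T)"
  proof (rule continuous_onI)
    fix x e assume "x \<in> T ` S" "(0::real) < e"
    then show "\<exists>d>0. \<forall>x'\<in>T ` S. dist x' x < d \<longrightarrow> dist (inv_into S T x') (inv_into S T x) \<le> e"
    proof (intro exI[of _ "c * e"] conjI ballI impI)
      fix x' assume "x' \<in> T ` S" "dist x' x < c * e"
      then obtain u v where uv: "u \<in> S" "v \<in> S" "x' = T u" "x = T v" using \<open>x \<in> T ` S\<close> by auto
      then have "c * dist u v \<le> c * e" using lip[of u v] \<open>dist x' x < c * e\<close> by simp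
      then show "dist (inv_into S T x') (inv_into S T x) \<le> e" using uv inj c(1) by simp
    qed (use c(1) in auto)
  qed
  then have "homeomorphism S (T ` S) T (inv_into S T)"
    using inj linear_continuous_on[OF T] by (auto simp: homeomorphism_def f_inv_into_f intro: rev_image_eqI)
  then show ?thesis unfolding iso_onto_image_def by blast
qed

lemma subspace_closed_span: "subspace (closed_span x)"
  by (simp add: closed_span_def subspace_closure)

text \<open>A closed infinite-dimensional sublattice on which \<open>T\<close> is an isomorphism contains the closed span of
  a disjoint sequence.\<close>

lemma DSS_imp_LSS:
  fixes T :: "'a::banach_lattice \<Rightarrow> 'b::banach"
  assumes T: "bounded_linear T" and D: "DSS T"
  shows "LSS T"
  unfolding LSS_def
proof (intro allI impI notI)
  fix S assume S: "sublattice S \<and> closed S \<and> infinite_dimensional S" and iso: "iso_onto_image S T"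
  have sub: "subspace S" using S by (simp add: sublattice_def)
  obtain y :: "nat \<Rightarrow> 'a" where y: "\<And>n. y n \<in> S" "\<And>n. y n \<noteq> 0" "\<And>m n. m \<noteq> n \<Longrightarrow> disjoint_vec (y m) (y n)"
    using infinite_disjoint_sequence[of S] S by blast
  have "closed_span y \<subseteq> S"
    unfolding closed_span_def using S sub y(1) by (intro closure_minimal span_minimal) auto
  moreover obtain c where "c > 0" "\<And>v. v \<in> S \<Longrightarrow> c * norm v \<le> norm (T v)"
    using iso_onto_image_lower_bound[OF T sub iso] by blast
  ultimately have "iso_onto_image (closed_span y) T"
    using T subspace_closed_span by (intro iso_onto_image_if_lower_bound[of T _ c]) auto
  then show False using D y unfolding DSS_def by blast
qed

lemma norm_le_norm_sum_disjoint:
  fixes x :: "nat \<Rightarrow> 'a::banach_lattice"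
  assumes "finite F" "\<And>m n. m \<noteq> n \<Longrightarrow> disjoint_vec (x m) (x n)" "k \<in> F"
  shows "\<bar>a k\<bar> * norm (x k) \<le> norm (\<Sum>k\<in>F. a k *\<^sub>R x k)"
proof -
  have "\<bar>\<Sum>k\<in>F. a k *\<^sub>R x k\<bar> = (\<Sum>k\<in>F. \<bar>a k *\<^sub>R x k\<bar>)"
    by (rule abs_sum_disjoint) (auto intro!: disjoint_vec_scaleR disjoint_vec_commute[OF disjoint_vec_scaleR] assms)
  moreover have "\<bar>a k *\<^sub>R x k\<bar> \<le> (\<Sum>k\<in>F. \<bar>a k *\<^sub>R x k\<bar>)"
    using assms(1,3) by (subst sum.remove[of F k]) (auto intro: sum_nonneg)
  ultimately have "norm (a k *\<^sub>R x k) \<le> norm (\<Sum>k\<in>F. a k *\<^sub>R x k)"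
    by (intro norm_lattice_mono) simp
  then show ?thesis by simp
qed

text \<open>Every construction of a witness against lattice strict singularity ends here: a lower bound on
  finite combinations passes to the closed span, which is a closed sublattice.  Its dimension is
  infinite because disjoint nonzero vectors are linearly independent.\<close>

lemma not_LSS_if_lower_bound:
  assumes T: "bounded_linear T" and y: "\<And>n. 0 \<le> y n" "\<And>n. y n \<noteq> 0" "\<And>m n. m \<noteq> n \<Longrightarrow> disjoint_vec (y m) (y n)"
    and c: "c > 0" "\<And>a n. c * norm (\<Sum>k<(n::nat). a k *\<^sub>R y k) \<le> norm (\<Sum>k<n. a k *\<^sub>R T (y k))"
  shows "\<not> LSS T"
proof -
  interpret bounded_linear T by fact
  have "span (range y) \<subseteq> {v. c * norm v \<le> norm (T v)}"
  proof
    fix v assume "v \<in> span (range y)"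
    then obtain a n where "v = (\<Sum>k<n. a k *\<^sub>R y k)" by (rule span_range_nat)
    then show "v \<in> {v. c * norm v \<le> norm (T v)}" using c(2)[where a = a] by (simp add: sum scaleR)
  qed
  moreover have "closed {v. c * norm v \<le> norm (T v)}"
    by (intro closed_Collect_le continuous_intros linear_continuous_on T)
  ultimately have "closed_span y \<subseteq> {v. c * norm v \<le> norm (T v)}"
    unfolding closed_span_def by (rule closure_minimal)
  then have iso: "iso_onto_image (closed_span y) T"
    using T subspace_closed_span c by (intro iso_onto_image_if_lower_bound[of T _ c]) auto
  have "infinite_dimensional (closed_span y)"
    unfolding infinite_dimensional_def
  proof
    assume "\<exists>B. finite B \<and> span B = closed_span y"
    then obtain B where B: "finite B" "span B = closed_span y" by blast
    have inj: "inj y"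
    proof (rule injI)
      fix m n assume *: "y m = y n"
      have "inf (y n) (y n) \<noteq> 0" using y(2)[of n] by simp
      then show "m = n" using y(3)[of m n] y(1)[of n] * by (auto simp: disjoint_vec_pos)
    qed
    have "independent (range y)"
      unfolding independent_explicit_module
    proof (intro allI impI)
      fix F u v assume F: "finite F" "F \<subseteq> range y" "(\<Sum>v\<in>F. u v *\<^sub>R v) = 0" "v \<in> F"
      obtain k where k: "v = y k" using F by auto
      have "F = y ` (y -` F)" using F(2) by auto
      then have "(\<Sum>v\<in>F. u v *\<^sub>R v) = (\<Sum>k\<in>y -` F. u (y k) *\<^sub>R y k)"
        using sum.reindex[of y "y -` F" "\<lambda>v. u v *\<^sub>R v"] inj by (simp add: inj_on_subset)
      moreover have "finite (y -` F)" using F(1) inj by (rule finite_vimageI)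
      ultimately have "\<bar>u (y k)\<bar> * norm (y k) \<le> 0"
        using norm_le_norm_sum_disjoint[of "y -` F" y k "u \<circ> y"] y(3) F k by simp
      then show "u v = 0" using y(2)[of k] k by (simp add: mult_le_0_iff)
    qed
    moreover have "range y \<subseteq> span B"
      unfolding B(2) closed_span_def 
      by (rule order_trans[OF span_superset closure_subset])
    ultimately have "finite (range y)" using independent_span_bound[OF B(1)] by simp
    then show False using inj by (simp add: finite_image_iff)
  qed
  moreover have "closed (closed_span y)" by (simp add: closed_span_def)
  moreover have "sublattice (closed_span y)" using y by (intro sublattice_closed_span)
  ultimately show ?thesis using iso unfolding LSS_def by blast
qed

section \<open>A Ramsey dichotomy for finite sets of naturals\<close>

text \<open>Let \<open>Q s M\<close> be a property that depends only on the part of \<open>M\<close> beyond \<open>s\<close>, passes to infinite subsets, and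
  can be achieved for each single \<open>s\<close> by shrinking \<open>M\<close>.  Then it can be achieved for all finite
  subsets of one set at once: choose a decreasing sequence of infinite sets, where the set number
  \<open>k + 1\<close> handles the finitely many \<open>s\<close> bounded by the minimum \<open>h k\<close> of its predecessor, and collect
  the minima.\<close>

lemma fusion:
  fixes Q :: "nat set \<Rightarrow> nat set \<Rightarrow> bool"
  assumes ex: "\<And>s M. finite s \<Longrightarrow> infinite M \<Longrightarrow> \<exists>N\<subseteq>M. infinite N \<and> Q s N"
    and mono: "\<And>s M N. finite s \<Longrightarrow> Q s M \<Longrightarrow> infinite N \<Longrightarrow> (\<And>x. x \<in> N \<Longrightarrow> \<forall>y\<in>s. y < x \<Longrightarrow> x \<in> M) \<Longrightarrow> Q s N"
    and M: "infinite M"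
  shows "\<exists>H\<subseteq>M. infinite H \<and> (\<forall>s\<subseteq>H. finite s \<longrightarrow> Q s H)"
proof -
  have many: "\<exists>N\<subseteq>L. infinite N \<and> (\<forall>s\<in>\<S>. Q s N)"
    if "finite \<S>" "\<And>s. s \<in> \<S> \<Longrightarrow> finite s" "infinite L" for \<S> L
    using that
  proof (induction \<S> rule: finite_induct)
    case (insert s \<S>)
    then obtain N where N: "N \<subseteq> L" "infinite N" "\<forall>s\<in>\<S>. Q s N" by auto
    obtain N' where "N' \<subseteq> N" "infinite N'" "Q s N'" using ex[of s N] insert.prems N by auto
    moreover from this have "\<forall>s\<in>\<S>. Q s N'"
      using N(3) insert.prems by (metis insertI2 mono subsetD)
    ultimately show ?case using N(1) by (intro exI[of _ N']) auto
  qed auto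
  have "\<exists>N :: nat \<Rightarrow> nat set. \<forall>k. (infinite (N k) \<and> N k \<subseteq> M \<and> Q {} (N k)) \<and>
      (N (Suc k) \<subseteq> N k \<inter> {Inf (N k)<..} \<and> (\<forall>s\<subseteq>{..Inf (N k)}. Q s (N (Suc k))))"
  proof (rule dependent_nat_choice)
    show "\<exists>N. infinite N \<and> N \<subseteq> M \<and> Q {} N" using ex[of "{}" M] M by auto
  next
    fix N assume N: "infinite N \<and> N \<subseteq> M \<and> Q {} N"
    have "infinite (N \<inter> {Inf N<..})"
    proof
      assume "finite (N \<inter> {Inf N<..})"
      then have "finite (N \<inter> {Inf N<..} \<union> {..Inf N})" by simp
      then have "finite N" by (rule rev_finite_subset) auto
      then show False using N by simp
    qed
    moreover have "finite s" if "s \<in> Pow {..Inf N}" for s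
      using that by (auto intro: finite_subset)
    ultimately obtain N' where "N' \<subseteq> N \<inter> {Inf N<..}" "infinite N'" "\<forall>s\<in>Pow {..Inf N}. Q s N'"
      using many[of "Pow {..Inf N}" "N \<inter> {Inf N<..}"] by auto
    then show "\<exists>N'. (infinite N' \<and> N' \<subseteq> M \<and> Q {} N') \<and>
        (N' \<subseteq> N \<inter> {Inf N<..} \<and> (\<forall>s\<subseteq>{..Inf N}. Q s N'))"
      using N by (intro exI[of _ N']) auto
  qed
  then obtain N :: "nat \<Rightarrow> nat set" where "\<forall>k. (infinite (N k) \<and> N k \<subseteq> M \<and> Q {} (N k)) \<and>
      (N (Suc k) \<subseteq> N k \<inter> {Inf (N k)<..} \<and> (\<forall>s\<subseteq>{..Inf (N k)}. Q s (N (Suc k))))" ..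
  then have N: "\<And>k. infinite (N k)" "\<And>k. N k \<subseteq> M" "\<And>k. Q {} (N k)"
    "\<And>k. N (Suc k) \<subseteq> N k \<inter> {Inf (N k)<..}" "\<And>k s. s \<subseteq> {..Inf (N k)} \<Longrightarrow> Q s (N (Suc k))" by simp_all
  define h where "h = (\<lambda>k. Inf (N k))"
  have h: "h k \<in> N k" for k unfolding h_def using N(1)[of k] by (intro Inf_nat_def1) auto
  have dec: "N (Suc k) \<subseteq> N k" for k using N(4)[of k] by blast
  have anti: "N j \<subseteq> N i" if "i \<le> j" for i j
    using that by (rule lift_Suc_antimono_le[of N, OF dec])
  have mono_h: "strict_mono h"
    unfolding strict_mono_Suc_iff using N(4) h unfolding h_def by blast
  have later: "h j \<in> N (Suc i)" if "h i < h j" for i j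
    using that h[of j] anti[of "Suc i" j] mono_h by (auto simp: strict_mono_less)
  have inf: "infinite (range h)" using mono_h by (simp add: finite_image_iff strict_mono_imp_inj_on)
  have "Q s (range h)" if s: "s \<subseteq> range h" "finite s" for s
  proof (cases "s = {}")
    case True
    then show ?thesis using mono[of "{}" "N 0" "range h"] N(3) inf h anti[of 0] by auto
  next
    case False
    then obtain k where k: "Max s = h k" using Max_in[OF s(2)] s(1) by auto
    have "s \<subseteq> {..Inf (N k)}" using Max_ge[OF s(2)] k by (auto simp: h_def)
    from N(5)[OF this] show ?thesis
    proof (rule mono[OF s(2) _ inf])
      fix x assume "x \<in> range h" "\<forall>y\<in>s. y < x"
      moreover have "h k \<in> s" using Max_in[OF s(2) False] k by simp
      ultimately show "x \<in> N (Suc k)" using later by auto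
    qed
  qed
  then show ?thesis using inf h N(2) by (intro exI[of _ "range h"]) auto
qed

text \<open>The notions of Nash-Williams: \<open>M\<close> accepts \<open>s\<close> if each infinite continuation of \<open>s\<close> inside \<open>M\<close> has an
  initial segment in \<open>\<S>\<close>.\<close>

definition accepts :: "nat set set \<Rightarrow> nat set \<Rightarrow> nat set \<Rightarrow> bool" where
  "accepts \<S> s M \<longleftrightarrow>
     (\<forall>K\<subseteq>M. infinite K \<and> (\<forall>x\<in>K. \<forall>y\<in>s. y < x) \<longrightarrow> (\<exists>n. (s \<union> K) \<inter> {..<n} \<in> \<S>))"

definition rejects :: "nat set set \<Rightarrow> nat set \<Rightarrow> nat set \<Rightarrow> bool" where
  "rejects \<S> s M \<longleftrightarrow> (\<forall>N\<subseteq>M. infinite N \<longrightarrow> \<not> accepts \<S> s N)"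

lemma accepts_mono:
  "accepts \<S> s M \<Longrightarrow> (\<And>x. x \<in> N \<Longrightarrow> \<forall>y\<in>s. y < x \<Longrightarrow> x \<in> M) \<Longrightarrow> accepts \<S> s N"
  unfolding accepts_def by (meson subset_iff)

lemma rejects_mono:
  assumes rej: "rejects \<S> s M" and s: "finite s" and N: "\<And>x. x \<in> N \<Longrightarrow> \<forall>y\<in>s. y < x \<Longrightarrow> x \<in> M"
  shows "rejects \<S> s N"
  unfolding rejects_def
proof (intro allI impI notI)
  fix K assume K: "K \<subseteq> N" "infinite K" "accepts \<S> s K"
  define K' where "K' = {x \<in> K. \<forall>y\<in>s. y < x}"
  have "finite (K - K')"
  proof (rule finite_subset)
    show "K - K' \<subseteq> (\<Union>y\<in>s. {..y})" by (auto simp: K'_def not_less)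
  qed (use s in auto)
  then have "infinite K'" using K(2) by (metis Diff_infinite_finite finite_Diff2)
  moreover have "K' \<subseteq> M" using K N by (auto simp: K'_def)
  moreover have "accepts \<S> s K'" using K(3) by (rule accepts_mono) (auto simp: K'_def)
  ultimately show False using rej unfolding rejects_def by blast
qed

text \<open>By fusion, pass to \<open>N\<close> that accepts or rejects each of its finite subsets.  If \<open>N\<close> accepts the empty
  set, the second alternative holds.  Otherwise rejection propagates: if \<open>N\<close> rejects \<open>s\<close>, only finitely
  many \<open>n\<close> can fail to make \<open>insert n s\<close> rejected, since infinitely many such \<open>n\<close> would form a set that
  accepts \<open>s\<close>.  A second fusion makes all finite subsets rejected, and rejected sets are not
  in \<open>\<S>\<close>.\<close>

theorem galvin_dichotomy:
  fixes \<S> :: "nat set set"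
  assumes M: "infinite M"
  shows "\<exists>H\<subseteq>M. infinite H \<and> ((\<forall>s\<subseteq>H. finite s \<longrightarrow> s \<notin> \<S>) \<or>
     (\<forall>K\<subseteq>H. infinite K \<longrightarrow> (\<exists>n. K \<inter> {..<n} \<in> \<S>)))"
proof -
  have "\<exists>N\<subseteq>M. infinite N \<and> (\<forall>s\<subseteq>N. finite s \<longrightarrow> accepts \<S> s N \<or> rejects \<S> s N)"
  proof (rule fusion[OF _ _ M])
    fix s L :: "nat set" assume "finite s" "infinite L"
    then show "\<exists>N\<subseteq>L. infinite N \<and> (accepts \<S> s N \<or> rejects \<S> s N)"
      unfolding rejects_def by (metis order_refl)
  next
    fix s L N :: "nat set"
    assume "finite s" "accepts \<S> s L \<or> rejects \<S> s L" "\<And>x. x \<in> N \<Longrightarrow> \<forall>y\<in>s. y < x \<Longrightarrow> x \<in> L"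
    then show "accepts \<S> s N \<or> rejects \<S> s N" using accepts_mono rejects_mono by metis
  qed
  then obtain N where N: "N \<subseteq> M" "infinite N"
    and decided: "\<And>s. s \<subseteq> N \<Longrightarrow> finite s \<Longrightarrow> accepts \<S> s N \<or> rejects \<S> s N" by blast
  show ?thesis
  proof (cases "accepts \<S> {} N")
    case True
    then show ?thesis using N unfolding accepts_def by (intro exI[of _ N]) auto
  next
    case False
    then have rej: "rejects \<S> {} N" using decided[of "{}"] by simp
    have "\<exists>H\<subseteq>N. infinite H \<and> (\<forall>s\<subseteq>H. finite s \<longrightarrow> s \<subseteq> N \<and> rejects \<S> s N \<longrightarrow>
        (\<forall>n\<in>H \<inter> N. (\<forall>y\<in>s. y < n) \<longrightarrow> rejects \<S> (insert n s) N))"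
    proof (rule fusion[OF _ _ N(2)])
      fix s L :: "nat set" assume s: "finite s" and L: "infinite L"
      define A where "A = {n \<in> L \<inter> N. (\<forall>y\<in>s. y < n) \<and> \<not> rejects \<S> (insert n s) N}"
      have "finite A" if sN: "s \<subseteq> N" "rejects \<S> s N"
      proof (rule ccontr)
        assume A: "infinite A"
        have "accepts \<S> s A"
          unfolding accepts_def
        proof (intro allI impI)
          fix K assume K: "K \<subseteq> A" "infinite K \<and> (\<forall>x\<in>K. \<forall>y\<in>s. y < x)"
          then have "K \<noteq> {}" by auto
          define n where "n = Inf K"
          have n: "n \<in> K" "\<And>x. x \<in> K \<Longrightarrow> n \<le> x"
            using \<open>K \<noteq> {}\<close> by (auto simp: n_def Inf_nat_def1 intro: wellorder_Inf_le1)
          then have nA: "n \<in> A" using K by auto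
          then have "accepts \<S> (insert n s) N"
            using decided[of "insert n s"] s sN(1) by (auto simp: A_def)
          moreover have "K - {n} \<subseteq> N" "infinite (K - {n})" using K by (auto simp: A_def)
          moreover have "\<forall>x\<in>K - {n}. \<forall>y\<in>insert n s. y < x" using K n by fastforce
          ultimately have "\<exists>m. (insert n s \<union> (K - {n})) \<inter> {..<m} \<in> \<S>"
            unfolding accepts_def by meson
          moreover have "insert n s \<union> (K - {n}) = s \<union> K" using n by auto
          ultimately show "\<exists>m. (s \<union> K) \<inter> {..<m} \<in> \<S>" by simp
        qed
        moreover have "A \<subseteq> N" by (auto simp: A_def)
        ultimately show False using A sN(2) unfolding rejects_def by blast
      qed
      then show "\<exists>H\<subseteq>L. infinite H \<and> (s \<subseteq> N \<and> rejects \<S> s N \<longrightarrow>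
          (\<forall>n\<in>H \<inter> N. (\<forall>y\<in>s. y < n) \<longrightarrow> rejects \<S> (insert n s) N))"
      proof (cases "s \<subseteq> N \<and> rejects \<S> s N")
        case True
        then have "infinite (L - A)" using \<open>s \<subseteq> N \<Longrightarrow> rejects \<S> s N \<Longrightarrow> finite A\<close> L by (simp add: Diff_infinite_finite)
        then show ?thesis by (intro exI[of _ "L - A"]) (auto simp: A_def)
      qed (use L in blast)
    next
      fix s L K :: "nat set"
      assume "s \<subseteq> N \<and> rejects \<S> s N \<longrightarrow> (\<forall>n\<in>L \<inter> N. (\<forall>y\<in>s. y < n) \<longrightarrow> rejects \<S> (insert n s) N)"
        "\<And>x. x \<in> K \<Longrightarrow> \<forall>y\<in>s. y < x \<Longrightarrow> x \<in> L"
      then show "s \<subseteq> N \<and> rejects \<S> s N \<longrightarrow> (\<forall>n\<in>K \<inter> N. (\<forall>y\<in>s. y < n) \<longrightarrow> rejects \<S> (insert n s) N)"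
        by blast
    qed
    then obtain H where H: "H \<subseteq> N" "infinite H"
      and H_step: "\<forall>s\<subseteq>H. finite s \<longrightarrow> s \<subseteq> N \<and> rejects \<S> s N \<longrightarrow>
        (\<forall>n\<in>H \<inter> N. (\<forall>y\<in>s. y < n) \<longrightarrow> rejects \<S> (insert n s) N)"
      by (elim exE conjE)
    have step: "\<And>s n. s \<subseteq> H \<Longrightarrow> finite s \<Longrightarrow> rejects \<S> s N \<Longrightarrow> n \<in> H \<Longrightarrow> \<forall>y\<in>s. y < n
        \<Longrightarrow> rejects \<S> (insert n s) N"
      using H_step H(1) by (simp add: subset_iff)
    have "rejects \<S> s N" if "finite s" "s \<subseteq> H" for s
      using that
    proof (induction s rule: finite_linorder_max_induct)
      case (insert n s)
      then show ?case using step[of s n] by auto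
    qed (rule rej)
    moreover have "accepts \<S> s N" if "s \<in> \<S>" for s
      unfolding accepts_def
    proof (intro allI impI)
      fix K assume K: "K \<subseteq> N" "infinite K \<and> (\<forall>x\<in>K. \<forall>y\<in>s. y < x)"
      then have "Inf K \<in> K" by (intro Inf_nat_def1) auto
      then have "(s \<union> K) \<inter> {..<Inf K} = s" using K(2) wellorder_Inf_le1[of _ K] by (auto simp: not_less[symmetric])
      then show "\<exists>n. (s \<union> K) \<inter> {..<n} \<in> \<S>" using that by metis
    qed
    ultimately have "\<forall>s\<subseteq>H. finite s \<longrightarrow> s \<notin> \<S>" using N(2) unfolding rejects_def by blast
    then show ?thesis using H N(1) by (intro exI[of _ H]) auto
  qed
qed

section \<open>Rosenthal's dichotomy for sequences of functions\<close>

lemma card_strict_mono_initial: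
  fixes e :: "nat \<Rightarrow> nat"
  assumes "strict_mono e" "e ` {..<i} \<subseteq> s" "s \<subseteq> range e"
  shows "card (s \<inter> {..<e i}) = i"
proof -
  have "s \<inter> {..<e i} = e ` {..<i}" using assms by (auto simp: strict_mono_less)
  then show ?thesis using assms(1) by (simp add: card_image strict_mono_imp_inj_on)
qed

text \<open>Apply Galvin's dichotomy to the finite sets \<open>s\<close> for which no point lies alternately in \<open>A\<close> and \<open>B\<close> along \<open>s\<close>.
  If every infinite subset of \<open>H\<close> has such an initial segment, no point can lie in both \<open>A n\<close> and
  \<open>B n\<close> for infinitely many \<open>n\<close>.  If no such \<open>s\<close> occurs in \<open>H\<close>, alternating patterns are
  always realised, and a sparse subset of \<open>H\<close> leaves room to shift any of its elements to an even or
  an odd position, which realises arbitrary patterns.\<close>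

lemma independent_or_convergent_subset:
  fixes A B :: "nat \<Rightarrow> 'w set"
  assumes M: "infinite M"
  shows "\<exists>H\<subseteq>M. infinite H \<and>
     ((\<forall>w. finite {n\<in>H. w \<in> A n} \<or> finite {n\<in>H. w \<in> B n}) \<or>
      (\<forall>P Q. finite P \<and> finite Q \<and> P \<subseteq> H \<and> Q \<subseteq> H \<and> P \<inter> Q = {} \<longrightarrow>
         (\<exists>w. (\<forall>n\<in>P. w \<in> A n) \<and> (\<forall>n\<in>Q. w \<in> B n))))"
proof -
  define C where "C = (\<lambda>i n. if even (i::nat) then A n else B n)"
  define \<S> where "\<S> = {s. finite s \<and> \<not> (\<exists>w. \<forall>j\<in>s. w \<in> C (card (s \<inter> {..<j})) j)}"
  obtain H where H: "H \<subseteq> M" "infinite H" and alt: "(\<forall>s\<subseteq>H. finite s \<longrightarrow> s \<notin> \<S>) \<or>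
     (\<forall>K\<subseteq>H. infinite K \<longrightarrow> (\<exists>n. K \<inter> {..<n} \<in> \<S>))"
    using galvin_dichotomy[OF M, of \<S>] by blast
  from alt show ?thesis
  proof
    assume none: "\<forall>s\<subseteq>H. finite s \<longrightarrow> s \<notin> \<S>"
    define h where "h = enumerate H"
    have h: "strict_mono h" "\<And>n. h n \<in> H"
      using H(2) by (auto simp: h_def strict_mono_enumerate enumerate_in_set)
    have hless: "h i < h j \<longleftrightarrow> i < j" for i j using h(1) by (rule strict_mono_less)
    define K where "K = range (\<lambda>i. h (3 * i + 1))"
    have "infinite K"
      unfolding K_def using h(1) by (intro range_inj_infinite injI) (auto simp: strict_mono_eq)
    moreover have "\<exists>w. (\<forall>n\<in>P. w \<in> A n) \<and> (\<forall>n\<in>Q. w \<in> B n)"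
      if PQ: "finite P" "finite Q" "P \<subseteq> K" "Q \<subseteq> K" "P \<inter> Q = {}" for P Q
    proof -
      \<comment> \<open>From the triple \<open>h (3 i), h (3 i + 1), h (3 i + 2)\<close> take two elements: the middle one comes
        first (an even position) if it is in \<open>P\<close>, and second (an odd position) otherwise.\<close>
      define e where "e = (\<lambda>j. let i = j div 2; p = h (3 * i + 1) \<in> P in
         if even j then (if p then h (3 * i + 1) else h (3 * i))
         else (if p then h (3 * i + 2) else h (3 * i + 1)))"
      have e: "strict_mono e"
        unfolding strict_mono_Suc_iff
      proof
        fix j show "e j < e (Suc j)"
          by (cases "even j") (auto simp: e_def Let_def hless elim!: oddE evenE)
      qed
      have eH: "range e \<subseteq> H" using h(2) by (auto simp: e_def Let_def)
      have "finite (P \<union> Q)" "P \<union> Q \<subseteq> K" using PQ by auto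
      then obtain I where I: "finite I" "P \<union> Q = (\<lambda>i. h (3 * i + 1)) ` I"
        unfolding K_def by (meson finite_subset_image)
      obtain k where k: "I \<subseteq> {..<k}" using I(1) finite_nat_bounded by blast
      have "e ` {..<2*k} \<notin> \<S>"
        using none eH by (metis finite_imageI finite_lessThan image_mono order_trans subset_UNIV)
      then obtain w where w: "\<And>j. j \<in> e ` {..<2*k} \<Longrightarrow> w \<in> C (card (e ` {..<2*k} \<inter> {..<j})) j"
        by (auto simp: \<S>_def)
      have we: "w \<in> C i (e i)" if "i < 2 * k" for i
        using w[of "e i"] that card_strict_mono_initial[OF e, of i "e ` {..<2*k}"] by force
      have "w \<in> A n" if "n \<in> P" for n
      proof -
        have "n \<in> (\<lambda>i. h (3 * i + 1)) ` I" using that I(2) by blast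
        then obtain i where i: "i < k" "n = h (3 * i + 1)" using k by auto
        show ?thesis using we[of "2 * i"] that unfolding i(2) by (simp add: C_def e_def i(1))
      qed
      moreover have "w \<in> B n" if "n \<in> Q" for n
      proof -
        have "n \<in> (\<lambda>i. h (3 * i + 1)) ` I" using that I(2) by blast
        then obtain i where i: "i < k" "n = h (3 * i + 1)" using k by auto
        have "n \<notin> P" using that PQ by auto
        then show ?thesis using we[of "2 * i + 1"] i(1) unfolding i(2) by (simp add: C_def e_def)
      qed
      ultimately show ?thesis by blast
    qed
    moreover have "K \<subseteq> M" using h(2) H(1) by (auto simp: K_def)
    ultimately show ?thesis by (intro exI[of _ K]) auto
  next
    assume all: "\<forall>K\<subseteq>H. infinite K \<longrightarrow> (\<exists>n. K \<inter> {..<n} \<in> \<S>)"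
    have "finite {n\<in>H. w \<in> A n} \<or> finite {n\<in>H. w \<in> B n}" for w
    proof (rule ccontr)
      assume "\<not> ?thesis"
      then have inf: "infinite {n\<in>H. w \<in> C i n}" for i by (cases "even i") (simp_all add: C_def)
      have "\<exists>e. \<forall>i. (e i \<in> H \<and> w \<in> C i (e i)) \<and> e i < e (Suc i)"
      proof (rule dependent_nat_choice)
        show "\<exists>n. n \<in> H \<and> w \<in> C 0 n" using infinite_imp_nonempty[OF inf[of 0]] by auto
      next
        fix n i :: nat
        show "\<exists>m. (m \<in> H \<and> w \<in> C (Suc i) m) \<and> n < m"
          using inf[of "Suc i"] unfolding infinite_nat_iff_unbounded by auto
      qed
      then obtain e where e: "\<And>i. e i \<in> H" "\<And>i. w \<in> C i (e i)" "strict_mono e"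
        unfolding strict_mono_Suc_iff by blast
      have "infinite (range e)" using e(3) by (intro range_inj_infinite strict_mono_imp_inj_on)
      then obtain n where n: "range e \<inter> {..<n} \<in> \<S>" using all e(1) by blast
      have "w \<in> C (card (range e \<inter> {..<n} \<inter> {..<e i})) (e i)" if "e i < n" for i
      proof -
        have "e ` {..<i} \<subseteq> range e \<inter> {..<n}"
          using that e(3) strict_mono_less[OF e(3)] by (auto intro: less_trans)
        then show ?thesis using card_strict_mono_initial[OF e(3), of i] e(2) by simp
      qed
      then show False using n by (auto simp: \<S>_def)
    qed
    then show ?thesis using H by blast
  qed
qed

lemma convergent_if_not_oscillating:
  fixes x :: "nat \<Rightarrow> real"
  assumes bdd: "\<And>n. \<bar>x n\<bar> \<le> C"
    and osc: "\<And>s t. s \<in> \<rat> \<Longrightarrow> t \<in> \<rat> \<Longrightarrow> s < t \<Longrightarrow> finite {n. x n < s} \<or> finite {n. t < x n}"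
  shows "convergent x"
proof -
  define R where "R = {q. infinite {n. q < x n}}"
  have ub: "q \<le> C" if "q \<in> R" for q
  proof (rule ccontr)
    assume "\<not> q \<le> C"
    then have "\<not> q < x n" for n using bdd[of n] by linarith
    then have "{n. q < x n} = {}" by simp
    then show False using that by (simp add: R_def)
  qed
  have bddR: "bdd_above R" using ub by (rule bdd_aboveI)
  have "{n. - C - 1 < x n} = UNIV"
  proof -
    have "- C - 1 < x n" for n using bdd[of n] by linarith
    then show ?thesis by auto
  qed
  then have neR: "- C - 1 \<in> R" by (simp add: R_def)
  define L where "L = Sup R"
  have "x \<longlonglongrightarrow> L"
  proof (rule LIMSEQ_I)
    fix e :: real assume e: "0 < e"
    have "L + e / 2 \<notin> R" using cSup_upper[OF _ bddR, of "L + e/2"] e by (auto simp: L_def)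
    then have 1: "eventually (\<lambda>n. x n \<le> L + e / 2) sequentially"
      by (simp add: R_def eventually_cofinite not_le flip: cofinite_eq_sequentially)
    obtain t where t: "t \<in> \<rat>" "L - e / 2 < t" "t < L" using Rats_dense_in_real[of "L - e/2" L] e by auto
    obtain s where s: "s \<in> \<rat>" "L - e < s" "s < L - e / 2" using Rats_dense_in_real[of "L - e" "L - e/2"] e by auto
    obtain q where "q \<in> R" "t < q" using less_cSup_iff[of R t] neR bddR t(3) by (auto simp: L_def)
    then have "infinite {n. q < x n}" "{n. q < x n} \<subseteq> {n. t < x n}" by (auto simp: R_def)
    then have "infinite {n. t < x n}" by (rule infinite_super[rotated])
    then have "finite {n. x n < s}" using osc[OF s(1) t(1)] s t by auto
    then have 2: "eventually (\<lambda>n. s \<le> x n) sequentially"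
      by (simp add: eventually_cofinite not_le flip: cofinite_eq_sequentially)
    have "eventually (\<lambda>n. norm (x n - L) < e) sequentially"
      using 1 2 by eventually_elim (use s e in \<open>auto simp: abs_less_iff\<close>)
    then show "\<exists>N. \<forall>n\<ge>N. norm (x n - L) < e" by (simp add: eventually_sequentially)
  qed
  then show ?thesis by (rule convergentI)
qed

text \<open>A bounded sequence of reals converges unless it crosses some rational gap \<open>(s, t)\<close> infinitely often.  If
  for some gap no infinite set excludes such crossings, the functions are independent along a
  subsequence.  Otherwise crossings of each single gap can be excluded by passing to a subset, and fusion,
  with the cardinality of \<open>s\<close> as the index of the gap, excludes them for all gaps at once.\<close>

theorem independent_or_pointwise_convergent:
  fixes \<phi> :: "nat \<Rightarrow> 'w \<Rightarrow> real"
  assumes bdd: "\<And>w. w \<in> \<Omega> \<Longrightarrow> \<exists>C. \<forall>n. \<bar>\<phi> n w\<bar> \<le> C"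
  shows "\<exists>r :: nat \<Rightarrow> nat. strict_mono r \<and> ((\<forall>w\<in>\<Omega>. convergent (\<lambda>n. \<phi> (r n) w)) \<or>
     (\<exists>s t. s < t \<and> (\<forall>P Q. finite P \<and> finite Q \<and> P \<inter> Q = {} \<and> P \<union> Q \<noteq> {} \<longrightarrow>
        (\<exists>w\<in>\<Omega>. (\<forall>n\<in>P. \<phi> (r n) w < s) \<and> (\<forall>n\<in>Q. t < \<phi> (r n) w)))))"
proof -
  define D where "D = {p \<in> \<rat> \<times> \<rat>. fst p < (snd p :: real)}"
  have "countable D" unfolding D_def by (rule countable_subset[of _ "\<rat> \<times> \<rat>"]) (auto simp: countable_rat)
  moreover have "(0, 1) \<in> D" by (simp add: D_def)
  ultimately obtain p :: "nat \<Rightarrow> real \<times> real" where p: "range p = D"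
    using range_from_nat_into[of D] by blast
  define A where "A = (\<lambda>k n. {w\<in>\<Omega>. \<phi> n w < fst (p k)})"
  define B where "B = (\<lambda>k n. {w\<in>\<Omega>. snd (p k) < \<phi> n w})"
  define conv where "conv = (\<lambda>k H. \<forall>w. finite {n\<in>H. w \<in> A k n} \<or> finite {n\<in>H. w \<in> B k n})"
  show ?thesis
  proof (cases "\<forall>k M. infinite M \<longrightarrow> (\<exists>N\<subseteq>M. infinite N \<and> conv k N)")
    case True
    have "\<exists>H\<subseteq>UNIV. infinite H \<and> (\<forall>s\<subseteq>H. finite s \<longrightarrow> conv (card s) H)"
    proof (rule fusion)
      fix s M N :: "nat set"
      assume s: "finite s" and c: "conv (card s) M" and N: "\<And>x. x \<in> N \<Longrightarrow> \<forall>y\<in>s. y < x \<Longrightarrow> x \<in> M"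
      have "finite {n\<in>N. w \<in> X n}" if "finite {n\<in>M. w \<in> X n}" for w and X :: "nat \<Rightarrow> 'w set"
      proof (rule finite_subset)
        show "{n\<in>N. w \<in> X n} \<subseteq> {n\<in>M. w \<in> X n} \<union> (\<Union>y\<in>s. {..y})" using N by (force simp: not_less)
      qed (use s that in auto)
      then show "conv (card s) N" using c unfolding conv_def by blast
    qed (use True in auto)
    then obtain H where H: "infinite H" "\<And>s. s \<subseteq> H \<Longrightarrow> finite s \<Longrightarrow> conv (card s) H" by auto
    have convH: "conv k H" for k
      using infinite_arbitrarily_large[OF H(1), of k] H(2) by blast
    define r where "r = enumerate H"
    have r: "strict_mono r" "\<And>n. r n \<in> H"
      using H(1) by (auto simp: r_def strict_mono_enumerate enumerate_in_set)
    have "convergent (\<lambda>n. \<phi> (r n) w)" if w: "w \<in> \<Omega>" for w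
    proof -
      obtain C where C: "\<And>n. \<bar>\<phi> n w\<bar> \<le> C" using bdd[OF w] by blast
      show ?thesis
      proof (rule convergent_if_not_oscillating)
        fix s t :: real assume "s \<in> \<rat>" "t \<in> \<rat>" "s < t"
        then have "(s, t) \<in> range p" by (simp add: p D_def)
        then obtain k where k: "p k = (s, t)" by auto
        have fin: "finite {n. Z (r n)}" if "finite {n\<in>H. Z n}" for Z :: "nat \<Rightarrow> bool"
        proof -
          have "{n. Z (r n)} \<subseteq> r -` {n\<in>H. Z n}" using r(2) by auto
          moreover have "finite (r -` {n\<in>H. Z n})"
            using that r(1) by (intro finite_vimageI) (auto simp: strict_mono_imp_inj_on)
          ultimately show ?thesis by (rule finite_subset)
        qed
        have "finite {n\<in>H. \<phi> n w < s} \<or> finite {n\<in>H. t < \<phi> n w}"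
          using convH[of k] w unfolding conv_def A_def B_def k by (drule_tac spec[of _ w]) simp
        then show "finite {n. \<phi> (r n) w < s} \<or> finite {n. t < \<phi> (r n) w}" 
          using fin[of "\<lambda>n. \<phi> n w < s"] fin[of "\<lambda>n. t < \<phi> n w"] by blast
      qed (rule C)
    qed
    then show ?thesis using r(1) by blast
  next
    case False
    then obtain k M where M: "infinite M" "\<And>N. N \<subseteq> M \<Longrightarrow> infinite N \<Longrightarrow> \<not> conv k N" by metis
    have "\<exists>H\<subseteq>M. infinite H \<and> (conv k H \<or>
      (\<forall>P Q. finite P \<and> finite Q \<and> P \<subseteq> H \<and> Q \<subseteq> H \<and> P \<inter> Q = {} \<longrightarrow>
         (\<exists>w. (\<forall>n\<in>P. w \<in> A k n) \<and> (\<forall>n\<in>Q. w \<in> B k n))))"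
      unfolding conv_def by (rule independent_or_convergent_subset[OF M(1)])
    then obtain H where H: "H \<subseteq> M" "infinite H" and "conv k H \<or>
      (\<forall>P Q. finite P \<and> finite Q \<and> P \<subseteq> H \<and> Q \<subseteq> H \<and> P \<inter> Q = {} \<longrightarrow>
         (\<exists>w. (\<forall>n\<in>P. w \<in> A k n) \<and> (\<forall>n\<in>Q. w \<in> B k n)))"
      by (elim exE conjE)
    then have ind: "\<exists>w. (\<forall>n\<in>P. w \<in> A k n) \<and> (\<forall>n\<in>Q. w \<in> B k n)"
      if "finite P" "finite Q" "P \<subseteq> H" "Q \<subseteq> H" "P \<inter> Q = {}" for P Q
      using that M(2)[OF H] by simp
    define r where "r = enumerate H"
    have r: "strict_mono r" "\<And>n. r n \<in> H"
      using H(2) by (auto simp: r_def strict_mono_enumerate enumerate_in_set)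
    have "\<exists>w\<in>\<Omega>. (\<forall>n\<in>P. \<phi> (r n) w < fst (p k)) \<and> (\<forall>n\<in>Q. snd (p k) < \<phi> (r n) w)"
      if PQ: "finite P" "finite Q" "P \<inter> Q = {}" "P \<union> Q \<noteq> {}" for P Q
    proof -
      have "r ` P \<inter> r ` Q = {}" using PQ(3) r(1) by (auto simp: strict_mono_eq)
      then obtain w where w: "\<forall>n\<in>r ` P. w \<in> A k n" "\<forall>n\<in>r ` Q. w \<in> B k n"
        using ind[of "r ` P" "r ` Q"] PQ(1,2) r(2) by (auto simp: image_subset_iff)
      then have "w \<in> \<Omega>" using PQ(4) by (auto simp: A_def B_def)
      then show ?thesis using w by (intro bexI[of _ w]) (auto simp: A_def B_def)
    qed
    moreover have "p k \<in> D" using p by blast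
    then have "fst (p k) < snd (p k)" by (simp add: D_def)
    ultimately show ?thesis
      by (intro exI[of _ r] conjI[OF r(1)] disjI2 exI[of _ "fst (p k)"] exI[of _ "snd (p k)"]) simp
  qed
qed

section \<open>Rosenthal's \<open>\<ell>\<^sub>1\<close> theorem\<close>

text \<open>Evaluate the \<open>u n\<close> on the dual unit ball.  In the independent case, choose functionals \<open>f\<close> and \<open>g\<close>
  that separate the positive from the negative coefficients in opposite ways; then \<open>g - f\<close> has norm at
  most \<open>2\<close> and value at least \<open>(t - s) \<Sum>\<bar>a k\<bar>\<close> at \<open>\<Sum>a k u k\<close>.\<close>

theorem rosenthal_l1:
  fixes u :: "nat \<Rightarrow> 'a::real_normed_vector"
  assumes bdd: "\<And>n. norm (u n) \<le> C"
  shows "\<exists>r :: nat \<Rightarrow> nat. strict_mono r \<and>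
    ((\<forall>f :: 'a \<Rightarrow> real. bounded_linear f \<longrightarrow> convergent (\<lambda>n. f (u (r n)))) \<or>
     (\<exists>d>0. \<forall>a n. d * (\<Sum>k<n. \<bar>a k\<bar>) \<le> norm (\<Sum>k<n. a k *\<^sub>R u (r k))))"
proof -
  define \<Omega> where "\<Omega> = {f :: 'a \<Rightarrow> real. linear f \<and> (\<forall>x. \<bar>f x\<bar> \<le> norm x)}"
  have "\<exists>C. \<forall>n. \<bar>f (u n)\<bar> \<le> C" if "f \<in> \<Omega>" for f
    using that bdd unfolding \<Omega>_def by (blast intro: order_trans)
  then have "\<exists>r :: nat \<Rightarrow> nat. strict_mono r \<and> ((\<forall>f\<in>\<Omega>. convergent (\<lambda>n. f (u (r n)))) \<or>
     (\<exists>s t. s < t \<and> (\<forall>P Q. finite P \<and> finite Q \<and> P \<inter> Q = {} \<and> P \<union> Q \<noteq> {} \<longrightarrow>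
        (\<exists>f\<in>\<Omega>. (\<forall>n\<in>P. f (u (r n)) < s) \<and> (\<forall>n\<in>Q. t < f (u (r n)))))))"
    by (rule independent_or_pointwise_convergent)
  then obtain r :: "nat \<Rightarrow> nat" where r: "strict_mono r"
    and alt: "(\<forall>f\<in>\<Omega>. convergent (\<lambda>n. f (u (r n)))) \<or>
     (\<exists>s t. s < t \<and> (\<forall>P Q. finite P \<and> finite Q \<and> P \<inter> Q = {} \<and> P \<union> Q \<noteq> {} \<longrightarrow>
        (\<exists>f\<in>\<Omega>. (\<forall>n\<in>P. f (u (r n)) < s) \<and> (\<forall>n\<in>Q. t < f (u (r n))))))"
    by (elim exE conjE)
  from alt show ?thesis
  proof
    assume conv: "\<forall>f\<in>\<Omega>. convergent (\<lambda>n. f (u (r n)))"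
    have "convergent (\<lambda>n. f (u (r n)))" if f: "bounded_linear f" for f :: "'a \<Rightarrow> real"
    proof -
      obtain K where K: "K > 0" "\<And>x. norm (f x) \<le> norm x * K"
        using bounded_linear.pos_bounded[OF f] by blast
      define g where "g = (\<lambda>x. inverse K * f x)"
      have "g \<in> \<Omega>"
        using K bounded_linear.linear[OF f]
        by (auto simp: g_def \<Omega>_def abs_mult field_simps linear_iff)
      then have "convergent (\<lambda>n. K * g (u (r n)))" using conv by (intro convergent_mult convergent_const) auto
      moreover have "(\<lambda>n. K * g (u (r n))) = (\<lambda>n. f (u (r n)))" using K(1) by (simp add: g_def fun_eq_iff)
      ultimately show ?thesis by simp
    qed
    then show ?thesis using r by blast
  next
    assume "\<exists>s t. s < t \<and> (\<forall>P Q. finite P \<and> finite Q \<and> P \<inter> Q = {} \<and> P \<union> Q \<noteq> {} \<longrightarrow>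
        (\<exists>f\<in>\<Omega>. (\<forall>n\<in>P. f (u (r n)) < s) \<and> (\<forall>n\<in>Q. t < f (u (r n)))))"
    then obtain s t where st: "s < t" and ind: "\<And>P Q. finite P \<Longrightarrow> finite Q \<Longrightarrow> P \<inter> Q = {} \<Longrightarrow> P \<union> Q \<noteq> {} \<Longrightarrow>
        (\<exists>f\<in>\<Omega>. (\<forall>n\<in>P. f (u (r n)) < s) \<and> (\<forall>n\<in>Q. t < f (u (r n))))" by metis
    have "(t - s) / 2 * (\<Sum>k<n. \<bar>a k\<bar>) \<le> norm (\<Sum>k<n. a k *\<^sub>R u (r k))" for a and n :: nat
    proof (cases "n = 0")
      case False
      define P where "P = {k. k < n \<and> 0 \<le> a k}"
      define Q where "Q = {k. k < n \<and> a k < 0}"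
      have PQ: "finite P" "finite Q" "P \<inter> Q = {}" "P \<union> Q = {..<n}" by (auto simp: P_def Q_def)
      then have ne: "P \<union> Q \<noteq> {}" "Q \<union> P \<noteq> {}" "Q \<inter> P = {}" using False by auto
      obtain f where f: "f \<in> \<Omega>" "\<forall>k\<in>P. f (u (r k)) < s" "\<forall>k\<in>Q. t < f (u (r k))"
        using ind[OF PQ(1-3) ne(1)] by blast
      obtain g where g: "g \<in> \<Omega>" "\<forall>k\<in>Q. g (u (r k)) < s" "\<forall>k\<in>P. t < g (u (r k))"
        using ind[OF PQ(2,1) ne(3,2)] by blast
      let ?v = "\<Sum>k<n. a k *\<^sub>R u (r k)"
      have lin: "h ?v = (\<Sum>k<n. a k * h (u (r k)))" if "h \<in> \<Omega>" for h
        using that by (simp add: \<Omega>_def linear_sum linear_scale)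
      have "(t - s) * (\<Sum>k<n. \<bar>a k\<bar>) \<le> (\<Sum>k<n. a k * (g (u (r k)) - f (u (r k))))"
        unfolding sum_distrib_left
      proof (rule sum_mono)
        fix k assume "k \<in> {..<n}"
        then consider "k \<in> P" | "k \<in> Q" using PQ by auto
        then show "(t - s) * \<bar>a k\<bar> \<le> a k * (g (u (r k)) - f (u (r k)))"
        proof cases
          case 1
          then have "0 \<le> a k" "t - s \<le> g (u (r k)) - f (u (r k))"
            using f(2) g(3) by (auto simp: P_def intro!: diff_mono intro: less_imp_le simp del: diff_le_eq)
          then show ?thesis using mult_left_mono[of "t - s" "g (u (r k)) - f (u (r k))" "a k"] by (simp add: mult.commute)
        next
          case 2
          then have "a k < 0" "t - s \<le> f (u (r k)) - g (u (r k))"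
            using f(3) g(2) by (auto simp: Q_def intro!: diff_mono intro: less_imp_le simp del: diff_le_eq)
          then show ?thesis using mult_left_mono[of "t - s" "f (u (r k)) - g (u (r k))" "- a k"] by (simp add: algebra_simps)
        qed
      qed
      also have "\<dots> = g ?v - f ?v" using f(1) g(1) by (simp add: lin right_diff_distrib sum_subtractf)
      also have "\<dots> \<le> 2 * norm ?v"
      proof -
        have "\<bar>g ?v\<bar> \<le> norm ?v" "\<bar>f ?v\<bar> \<le> norm ?v" using f(1) g(1) by (auto simp: \<Omega>_def)
        then show ?thesis by linarith
      qed
      finally show ?thesis by simp
    qed simp
    moreover have "(t - s) / 2 > 0" using st by simp
    ultimately show ?thesis using r by blast
  qed
qed

section \<open>The Hahn--Banach theorem\<close>

definition sublinear :: "('a::real_vector \<Rightarrow> real) \<Rightarrow> bool" where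
  "sublinear p \<longleftrightarrow> (\<forall>x y. p (x + y) \<le> p x + p y) \<and> (\<forall>c x. 0 \<le> c \<longrightarrow> p (c *\<^sub>R x) = c * p x)"

lemma sublinearD:
  assumes "sublinear p"
  shows "p (x + y) \<le> p x + p y" "0 \<le> c \<Longrightarrow> p (c *\<^sub>R x) = c * p x" "p 0 = 0" "- p (- x) \<le> p x"
proof -
  show 1: "p (x + y) \<le> p x + p y" and 2: "0 \<le> c \<Longrightarrow> p (c *\<^sub>R x) = c * p x" for c x y
    using assms by (auto simp: sublinear_def)
  show 0: "p 0 = 0" using 2[of 0 0] by simp
  show "- p (- x) \<le> p x" using 1[of x "-x"] 0 by simp
qed

lemma sublinearI:
  assumes add: "\<And>x y. p (x + y) \<le> p x + p y" and scale: "\<And>c x. 0 < c \<Longrightarrow> p (c *\<^sub>R x) \<le> c * p x" and "p 0 = 0"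
  shows "sublinear p"
proof -
  have "p (c *\<^sub>R x) = c * p x" if "0 \<le> c" for c x
  proof (cases "c = 0")
    case False
    then have c: "0 < c" using that by simp
    have "p x \<le> inverse c * p (c *\<^sub>R x)" using scale[of "inverse c" "c *\<^sub>R x"] c by simp
    then have "c * p x \<le> p (c *\<^sub>R x)" using c by (simp add: field_simps)
    then show ?thesis using scale[OF c, of x] by simp
  qed (use assms in simp)
  then show ?thesis using add by (simp add: sublinear_def)
qed

text \<open>For each \<open>y\<close>, the functional \<open>q' x = inf\<^bsub>t \<ge> 0\<^esub> (q (x + t y) - t q y)\<close> is sublinear and below \<open>q\<close>,
  hence equal to \<open>q\<close>.  At \<open>x = - y\<close>, \<open>t = 1\<close> this gives \<open>q (- y) \<le> - q y\<close>.\<close>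

lemma linear_if_minimal_sublinear:
  assumes q: "sublinear q" and min: "\<And>q'. sublinear q' \<Longrightarrow> (\<And>x. q' x \<le> q x) \<Longrightarrow> q' = q"
  shows "linear q"
proof -
  note [simp] = sublinearD(3)[OF q]
  have neg: "q (- y) = - q y" for y
  proof -
    define F where "F = (\<lambda>x t. q (x + t *\<^sub>R y) - t * q y)"
    define q' where "q' = (\<lambda>x. INF t\<in>{0..}. F x t)"
    have F_lower: "- q (- x) \<le> F x t" if "0 \<le> t" for x t
      using sublinearD(1)[OF q, of "x + t *\<^sub>R y" "- x"] sublinearD(2)[OF q that, of y]
      by (simp add: F_def algebra_simps)
    have bdd: "bdd_below (F x ` {0..})" for x using F_lower by (intro bdd_belowI2) auto
    have q'_le: "q' x \<le> F x t" if "0 \<le> t" for x t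
      unfolding q'_def using that by (intro cINF_lower bdd) auto
    have q'_ge: "b \<le> q' x" if "\<And>t. 0 \<le> t \<Longrightarrow> b \<le> F x t" for b x
      unfolding q'_def using that by (intro cINF_greatest) auto
    have "sublinear q'"
    proof (rule sublinearI)
      fix x z
      have "q' (x + z) \<le> F x s + F z t" if "0 \<le> s" "0 \<le> t" for s t
      proof -
        have "q' (x + z) \<le> F (x + z) (s + t)" using that by (intro q'_le) auto
        also have "\<dots> \<le> F x s + F z t"
          using sublinearD(1)[OF q, of "x + s *\<^sub>R y" "z + t *\<^sub>R y"] by (simp add: F_def algebra_simps)
        finally show ?thesis .
      qed
      then have "q' (x + z) - F z t \<le> q' x" if "0 \<le> t" for t
        using that by (intro q'_ge) (simp add: diff_le_eq)
      then have "q' (x + z) - q' x \<le> q' z" by (intro q'_ge) (simp add: diff_le_eq algebra_simps)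
      then show "q' (x + z) \<le> q' x + q' z" by simp
    next
      fix c :: real and x assume c: "0 < c"
      have "inverse c * q' (c *\<^sub>R x) \<le> F x t" if "0 \<le> t" for t
      proof -
        have "q' (c *\<^sub>R x) \<le> F (c *\<^sub>R x) (c * t)" using c that by (intro q'_le) auto
        also have "\<dots> = c * F x t"
          using sublinearD(2)[OF q, of c "x + t *\<^sub>R y"] c by (simp add: F_def algebra_simps)
        finally show ?thesis using c by (simp add: field_simps)
      qed
      then have "inverse c * q' (c *\<^sub>R x) \<le> q' x" by (rule q'_ge)
      then show "q' (c *\<^sub>R x) \<le> c * q' x" using c by (simp add: field_simps)
    next
      show "q' 0 = 0"
        using q'_le[of 0 0] q'_ge[of 0 0] F_lower[of _ 0] by (auto simp: F_def intro!: antisym)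
    qed
    moreover have "q' x \<le> q x" for x using q'_le[of 0 x] by (simp add: F_def)
    ultimately have "q' = q" by (rule min)
    then have "q (- y) \<le> - q y" using q'_le[of 1 "- y"] by (simp add: F_def)
    then show ?thesis using sublinearD(4)[OF q, of y] by simp
  qed
  have "q (x + y) = q x + q y" for x y
    using sublinearD(1)[OF q, of x y] sublinearD(1)[OF q, of "-x" "-y"] neg[of "x + y"] by (simp add: neg)
  moreover have "q (c *\<^sub>R x) = c * q x" for c x
    using sublinearD(2)[OF q, of c x] sublinearD(2)[OF q, of "-c" x] neg[of "c *\<^sub>R x"] by (cases "0 \<le> c") auto
  ultimately show ?thesis by (intro linearI) auto
qed

text \<open>Zorn's lemma gives a minimal sublinear functional below \<open>p\<close>; chains have pointwise infima.\<close>

theorem linear_below_sublinear: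
  fixes p :: "'a::real_vector \<Rightarrow> real"
  assumes p: "sublinear p"
  shows "\<exists>f. linear f \<and> (\<forall>x. f x \<le> p x)"
proof -
  define A where "A = {q :: 'a \<Rightarrow> real. sublinear q \<and> (\<forall>x. q x \<le> p x)}"
  define P where "P = (\<lambda>q q' :: 'a \<Rightarrow> real. \<forall>x. q' x \<le> q x)"
  have "\<exists>m\<in>A. \<forall>a\<in>A. P m a \<longrightarrow> a = m"
  proof (rule predicate_Zorn)
    show "partial_order_on A (relation_of P A)"
      by (rule partial_order_on_relation_ofI) (auto simp: P_def fun_eq_iff intro: order_trans antisym)
  next
    fix C assume C: "C \<in> Chains (relation_of P A)"
    have CA: "C \<subseteq> A" and chain: "P q q' \<or> P q' q" if "q \<in> C" "q' \<in> C" for q q'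
      using C that by (auto simp: Chains_def relation_of_def)
    show "\<exists>u\<in>A. \<forall>a\<in>C. P a u"
    proof (cases "C = {}")
      case True
      then show ?thesis using p by (intro bexI[of _ p]) (auto simp: A_def)
    next
      case False
      have sub: "sublinear q" and le: "q x \<le> p x" if "q \<in> C" for q x
        using C that by (auto simp: Chains_def relation_of_def A_def)
      define u where "u = (\<lambda>x. INF q\<in>C. q x)"
      have "- p (- x) \<le> q x" if "q \<in> C" for q x
        using sublinearD(4)[OF sub[OF that], of x] le[OF that, of "-x"] by linarith
      then have bdd: "bdd_below ((\<lambda>q. q x) ` C)" for x by (intro bdd_belowI2) auto
      have u_le: "u x \<le> q x" if "q \<in> C" for q x
        unfolding u_def using that by (intro cINF_lower bdd)
      have u_ge: "b \<le> u x" if "\<And>q. q \<in> C \<Longrightarrow> b \<le> q x" for b x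
        unfolding u_def using that False by (intro cINF_greatest) auto
      have "sublinear u"
      proof (rule sublinearI)
        fix x y
        have "u (x + y) \<le> q x + q' y" if q: "q \<in> C" "q' \<in> C" for q q'
        proof -
          obtain r where "r \<in> C" "r x \<le> q x" "r y \<le> q' y" using chain[OF q] q unfolding P_def by blast
          then show ?thesis using u_le[of r "x + y"] sublinearD(1)[OF sub, of r x y] by linarith
        qed
        then have "u (x + y) - q' y \<le> u x" if "q' \<in> C" for q'
          using that by (intro u_ge) (simp add: diff_le_eq)
        then have "u (x + y) - u x \<le> u y" by (intro u_ge) (simp add: diff_le_eq algebra_simps)
        then show "u (x + y) \<le> u x + u y" by simp
      next
        fix c :: real and x assume c: "0 < c"
        have "inverse c * u (c *\<^sub>R x) \<le> q x" if "q \<in> C" for q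
          using u_le[OF that, of "c *\<^sub>R x"] sublinearD(2)[OF sub[OF that], of c x] c by (simp add: field_simps)
        then have "inverse c * u (c *\<^sub>R x) \<le> u x" by (rule u_ge)
        then show "u (c *\<^sub>R x) \<le> c * u x" using c by (simp add: field_simps)
      next
        have "(\<lambda>q. q 0) ` C = {0}" using False sublinearD(3)[OF sub] by force
        then show "u 0 = 0" by (simp add: u_def)
      qed
      moreover have "u x \<le> p x" for x using False u_le le by (meson ex_in_conv order_trans)
      ultimately show ?thesis using u_le by (intro bexI[of _ u]) (auto simp: A_def P_def)
    qed
  qed
  then obtain q where q: "q \<in> A" "\<And>q'. q' \<in> A \<Longrightarrow> P q q' \<Longrightarrow> q' = q" by blast
  have "linear q"
  proof (rule linear_if_minimal_sublinear)
    show "sublinear q" using q(1) by (simp add: A_def)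
    fix q' assume "sublinear q'" "\<And>x. q' x \<le> q x"
    then show "q' = q" using q(1) by (intro q(2)) (auto simp: A_def P_def intro: order_trans)
  qed
  then show ?thesis using q(1) by (auto simp: A_def)
qed

text \<open>The functional to be extended is given by its graph \<open>G\<close>.  A linear functional below
  \<open>p x = inf\<^bsub>(y, t) \<in> G\<^esub> (K \<parallel>x - y\<parallel> + t)\<close> is bounded by \<open>K\<close> and is at most \<open>t\<close> at \<open>y\<close> for each \<open>(y, t)\<close>
  in \<open>G\<close>; applied to \<open>(- y, - t)\<close>, this gives equality.\<close>

theorem hahn_banach_graph:
  fixes G :: "('a::real_normed_vector \<times> real) set"
  assumes G: "subspace G" and bound: "\<And>y t. (y, t) \<in> G \<Longrightarrow> t \<le> K * norm y" and K: "0 \<le> K"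
  shows "\<exists>f. bounded_linear f \<and> (\<forall>(y, t)\<in>G. f y = t)"
proof -
  define p where "p = (\<lambda>x. INF g\<in>G. K * norm (x - fst g) + snd g)"
  have neg: "- t \<le> K * norm y" if "(y, t) \<in> G" for y t
    using bound[of "-y" "-t"] subspace_neg[OF G that] by simp
  have lower: "- (K * norm x) \<le> K * norm (x - fst g) + snd g" if "g \<in> G" for x g
  proof -
    have "norm (fst g) \<le> norm (x - fst g) + norm x"
      using norm_triangle_ineq4[of "x - fst g" x] by simp
    then have "K * norm (fst g) \<le> K * norm (x - fst g) + K * norm x"
      using mult_left_mono[OF _ K] by (fastforce simp: distrib_left)
    moreover have "- snd g \<le> K * norm (fst g)" using neg that by (metis prod.collapse)
    ultimately show ?thesis by linarith
  qed
  have G0: "(0, 0) \<in> G" using subspace_0[OF G] by (simp add: zero_prod_def)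
  have bdd: "bdd_below ((\<lambda>g. K * norm (x - fst g) + snd g) ` G)" for x
    using lower by (intro bdd_belowI2) auto
  have p_le: "p x \<le> K * norm (x - fst g) + snd g" if "g \<in> G" for x g
    unfolding p_def using that by (intro cINF_lower bdd)
  have p_ge: "b \<le> p x" if "\<And>g. g \<in> G \<Longrightarrow> b \<le> K * norm (x - fst g) + snd g" for b x
    unfolding p_def using that G0 by (intro cINF_greatest) auto
  have "sublinear p"
  proof (rule sublinearI)
    fix x y
    have le: "p (x + y) \<le> (K * norm (x - fst g) + snd g) + (K * norm (y - fst h) + snd h)"
      if "g \<in> G" "h \<in> G" for g h
    proof -
      have "p (x + y) \<le> K * norm (x + y - fst (g + h)) + snd (g + h)"
        using that G by (intro p_le subspace_add)
      moreover have "norm (x + y - fst (g + h)) \<le> norm (x - fst g) + norm (y - fst h)"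
        using norm_triangle_ineq[of "x - fst g" "y - fst h"] by (simp add: algebra_simps)
      from mult_left_mono[OF this K]
      have "K * norm (x + y - fst (g + h)) \<le> K * norm (x - fst g) + K * norm (y - fst h)"
        by (simp add: distrib_left)
      ultimately show ?thesis by simp
    qed
    have "p (x + y) - (K * norm (y - fst h) + snd h) \<le> p x" if "h \<in> G" for h
      by (rule p_ge) (use le that in \<open>simp add: diff_le_eq\<close>)
    then have "p (x + y) - p x \<le> p y" by (intro p_ge) (simp add: diff_le_eq algebra_simps)
    then show "p (x + y) \<le> p x + p y" by simp
  next
    fix c :: real and x :: 'a assume c: "0 < c"
    have "inverse c * p (c *\<^sub>R x) \<le> K * norm (x - fst g) + snd g" if "g \<in> G" for g
    proof -
      have "p (c *\<^sub>R x) \<le> K * norm (c *\<^sub>R x - fst (c *\<^sub>R g)) + snd (c *\<^sub>R g)"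
        using that G by (intro p_le subspace_scale)
      also have "\<dots> = c * (K * norm (x - fst g) + snd g)"
        using c by (simp add: algebra_simps flip: scaleR_right_diff_distrib)
      finally show ?thesis using c by (simp add: field_simps)
    qed
    then have "inverse c * p (c *\<^sub>R x) \<le> p x" by (rule p_ge)
    then show "p (c *\<^sub>R x) \<le> c * p x" using c by (simp add: field_simps)
  next
    show "p 0 = 0" using p_le[OF G0, of 0] p_ge[of 0 0] lower[of _ 0] by (auto intro!: antisym)
  qed
  then obtain f where f: "linear f" "\<And>x. f x \<le> p x" using linear_below_sublinear by blast
  have f_le: "f x \<le> K * norm x" for x using f(2)[of x] p_le[OF G0, of x] by simp
  have "bounded_linear f"
  proof (rule bounded_linear_intro)
    show "norm (f x) \<le> norm x * K" for x
      using f_le[of x] f_le[of "-x"] linear_neg[OF f(1), of x] by (simp add: mult.commute abs_le_iff)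
  qed (use f(1) in \<open>auto simp: linear_add linear_scale\<close>)
  moreover have "f y = t" if "(y, t) \<in> G" for y t
  proof (rule antisym)
    show "f y \<le> t" using f(2)[of y] p_le[OF that, of y] by simp
    have "(- y, - t) \<in> G" using subspace_neg[OF G that] by simp
    from p_le[OF this, of "- y"] show "t \<le> f y" using f(2)[of "-y"] linear_neg[OF f(1), of y] by simp
  qed
  ultimately show ?thesis by blast
qed

section \<open>Functionals on \<open>\<ell>\<^sub>1\<close>-sequences\<close>

lemma l1_sequence_interpolation:
  fixes w :: "nat \<Rightarrow> 'a::real_normed_vector"
  assumes c: "c > 0" "\<And>a n. c * (\<Sum>k<(n::nat). \<bar>a k\<bar>) \<le> norm (\<Sum>k<n. a k *\<^sub>R w k)"
    and b: "\<And>n. \<bar>b n\<bar> \<le> (1::real)"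
  shows "\<exists>f :: 'a \<Rightarrow> real. bounded_linear f \<and> (\<forall>n. f (w n) = b n)"
proof -
  let ?G = "span (range (\<lambda>n. (w n, b n)))"
  have "\<exists>f. bounded_linear f \<and> (\<forall>(y, t)\<in>?G. f y = t)"
  proof (rule hahn_banach_graph)
    fix y t assume "(y, t) \<in> ?G"
    then obtain a n where "(y, t) = (\<Sum>k<n. a k *\<^sub>R (w k, b k))" by (rule span_range_nat)
    then have y: "y = (\<Sum>k<n. a k *\<^sub>R w k)" and t: "t = (\<Sum>k<n. a k * b k)"
      by (simp_all add: prod_eq_iff fst_sum snd_sum)
    have "t \<le> (\<Sum>k<n. \<bar>a k\<bar>)"
      unfolding t using b by (intro sum_mono) (metis abs_ge_self abs_ge_zero abs_mult mult_left_le order_trans)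
    also have "\<dots> \<le> inverse c * norm y" using c(2)[where a = a and n = n] c(1) by (simp add: y field_simps)
    finally show "t \<le> inverse c * norm y" .
  qed (use c(1) in auto)
  then obtain f where "bounded_linear f" "\<forall>(y, t)\<in>?G. f y = t" by blast
  moreover have "(w n, b n) \<in> ?G" for n by (intro span_base) auto
  ultimately show ?thesis by (intro exI[of _ f]) fast
qed

text \<open>A functional can take the values \<open>1, -1, 1, -1, \<dots>\<close> along the sequence.\<close>

lemma l1_sequence_not_weakly_Cauchy:
  fixes w :: "nat \<Rightarrow> 'a::real_normed_vector"
  assumes c: "c > 0" "\<And>a n. c * (\<Sum>k<(n::nat). \<bar>a k\<bar>) \<le> norm (\<Sum>k<n. a k *\<^sub>R w k)"
  shows "\<exists>f :: 'a \<Rightarrow> real. bounded_linear f \<and> \<not> convergent (\<lambda>n. f (w n))"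
proof -
  obtain f :: "'a \<Rightarrow> real" where f: "bounded_linear f" "\<And>n. f (w n) = (-1) ^ n"
    using l1_sequence_interpolation[of c w "\<lambda>n. (-1) ^ n"] c by (auto simp: power_abs)
  have "\<not> convergent (\<lambda>n. (-1) ^ n :: real)"
  proof
    assume "convergent (\<lambda>n. (-1) ^ n :: real)"
    then obtain L :: real where L: "(\<lambda>n. (-1) ^ n) \<longlonglongrightarrow> L" by (auto simp: convergent_def)
    have "(\<lambda>n. (-1 :: real) ^ (2 * n)) \<longlonglongrightarrow> L" "(\<lambda>n. (-1 :: real) ^ (2 * n + 1)) \<longlonglongrightarrow> L"
      using LIMSEQ_subseq_LIMSEQ[OF L, of "\<lambda>n. 2 * n"] LIMSEQ_subseq_LIMSEQ[OF L, of "\<lambda>n. 2 * n + 1"]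
      by (auto simp: strict_mono_def o_def)
    then have "(\<lambda>n. 1 :: real) \<longlonglongrightarrow> L" "(\<lambda>n. -1 :: real) \<longlonglongrightarrow> L" by simp_all
    then have "L = 1" "L = -1" using LIMSEQ_unique tendsto_const by metis+
    then show False by simp
  qed
  then show ?thesis using f by auto
qed

section \<open>The basis constant of a basic sequence\<close>

lemma Baire_closed_cover:
  fixes Y :: "'a::complete_space set"
  assumes Y: "closed Y" "Y \<noteq> {}" and cover: "Y \<subseteq> (\<Union>k::nat. closure (A k))"
  shows "\<exists>k. \<exists>v\<in>Y. \<exists>d>0. Y \<inter> ball v d \<subseteq> closure (A k)"
proof -
  let ?X = "top_of_set Y"
  let ?G = "range (\<lambda>k. Y \<inter> closure (A k))"
  have "completely_metrizable_space ?X"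
    by (rule completely_metrizable_space_closedin[OF completely_metrizable_space_euclidean])
      (use Y(1) in \<open>simp only: closed_closedin\<close>)
  moreover have "?X interior_of \<Union>?G \<noteq> {}"
  proof -
    have "\<Union>?G = topspace ?X" using cover by auto
    then have "?X interior_of \<Union>?G = topspace ?X" by (simp only: interior_of_topspace)
    then have "?X interior_of \<Union>?G = Y" by (simp only: topspace_euclidean_subtopology)
    then show ?thesis using Y(2) by simp
  qed
  ultimately obtain T where T: "T \<in> ?G" "\<not> (closedin ?X T \<and> ?X interior_of T = {})"
    using Baire_category_alt[of ?X ?G] by auto
  then obtain k where k: "T = Y \<inter> closure (A k)" by blast
  have "closedin ?X T" unfolding k by (simp add: closedin_closed_Int)
  then obtain v where v: "v \<in> ?X interior_of T" using T(2) by blast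
  have "openin ?X (?X interior_of T)" by simp
  then obtain O' where O': "open O'" "?X interior_of T = Y \<inter> O'" unfolding openin_open by (elim exE conjE)
  then obtain d where "d > 0" "ball v d \<subseteq> O'" using v openE[of O' v] by blast
  moreover have "Y \<inter> O' \<subseteq> closure (A k)" using O'(2) interior_of_subset[of ?X T] k by auto
  ultimately show ?thesis using v O'(2) by blast
qed

lemma basic_sequence_coefficients_unique:
  assumes "basic_sequence u" "v \<in> closed_span u"
    and "(\<lambda>k. a k *\<^sub>R u k) sums v" "(\<lambda>k. b k *\<^sub>R u k) sums v"
  shows "a = b"
proof -
  have "\<exists>!a. (\<lambda>k. a k *\<^sub>R u k) sums v" using assms(1,2) by (simp add: basic_sequence_def)
  then obtain c where c: "\<forall>a. (\<lambda>k. a k *\<^sub>R u k) sums v \<longrightarrow> a = c" by (elim ex1E)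
  have "a = c" "b = c" by (rule c[rule_format], fact)+
  then show ?thesis by simp
qed

lemma basic_sequence_nonzero:
  assumes "basic_sequence u"
  shows "u n \<noteq> 0"
proof
  assume 0: "u n = 0"
  have "0 \<in> closed_span u" using subspace_closed_span by (rule subspace_0)
  moreover have "(\<lambda>k. (if k = n then 1 else 0) *\<^sub>R u k) = (\<lambda>k. 0)" using 0 by auto
  then have "(\<lambda>k. (if k = n then 1 else 0) *\<^sub>R u k) sums 0" using sums_zero by metis
  moreover have "(\<lambda>k. 0 *\<^sub>R u k) sums 0" by simp
  ultimately have "(\<lambda>k. if k = n then 1 else (0::real)) = (\<lambda>k. 0)"
    by (rule basic_sequence_coefficients_unique[OF assms])
  then show False by (metis zero_neq_one)
qed

text \<open>By Baire's theorem, vectors with an expansion whose partial sums are bounded by a fixed number are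
  dense in some ball of the closed span; by subtraction and scaling, each \<open>v\<close> can be
  approximated up to half its norm by a vector whose partial sums are bounded by \<open>C \<parallel>v\<parallel>\<close>.  Iterating on the
  remainders and adding the resulting series gives an expansion of \<open>v\<close> with partial sums bounded by
  \<open>2 C \<parallel>v\<parallel>\<close>.  By uniqueness it is the given one when \<open>v\<close> is a finite combination.\<close>

theorem basis_constant:
  fixes u :: "nat \<Rightarrow> 'a::banach"
  assumes u: "basic_sequence u"
  shows "\<exists>K>0. \<forall>a m n. m \<le> n \<longrightarrow> norm (\<Sum>k<m. a k *\<^sub>R u k) \<le> K * norm (\<Sum>k<n. a k *\<^sub>R u k)"
proof -
  define Y where "Y = closed_span u"
  have subY: "subspace Y" unfolding Y_def by (rule subspace_closed_span)
  \<comment> \<open>\<open>E a b v\<close>: the coefficients \<open>a\<close> expand \<open>v\<close> with partial sums bounded by \<open>b\<close>\<close>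
  define E where "E = (\<lambda>a b v. (\<lambda>n. a n *\<^sub>R u n) sums v \<and> (\<forall>n. norm (\<Sum>k<n. a k *\<^sub>R u k) \<le> b))"
  have EY: "v \<in> Y" if "E a b v" for a b v
  proof -
    have "(\<lambda>n. \<Sum>k<n. a k *\<^sub>R u k) \<longlonglongrightarrow> v" using that by (simp add: E_def sums_def)
    moreover have "(\<Sum>k<n. a k *\<^sub>R u k) \<in> span (range u)" for n
      by (intro span_sum span_scale span_base) auto
    ultimately show ?thesis unfolding Y_def closed_span_def closure_sequential
      by (intro exI[of _ "\<lambda>n. \<Sum>k<n. a k *\<^sub>R u k"]) simp
  qed
  define A where "A = (\<lambda>k::nat. {v. \<exists>a. E a (real k) v})"
  have "Y \<subseteq> (\<Union>k. closure (A k))"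
  proof
    fix v assume "v \<in> Y"
    then obtain a where a: "(\<lambda>n. a n *\<^sub>R u n) sums v" using u by (auto simp: basic_sequence_def Y_def)
    then have "Bseq (\<lambda>n. \<Sum>k<n. a k *\<^sub>R u k)"
      by (intro convergent_imp_Bseq) (auto simp: sums_def convergent_def)
    then obtain B where "\<And>n. norm (\<Sum>k<n. a k *\<^sub>R u k) \<le> B" by (auto simp: Bseq_def)
    moreover obtain k where "B \<le> real k" using real_arch_simple by blast
    ultimately have "E a (real k) v" using a unfolding E_def by (meson order_trans)
    then have "v \<in> A k" by (auto simp: A_def)
    then show "v \<in> (\<Union>k. closure (A k))" using closure_subset by blast
  qed
  moreover have "closed Y" "Y \<noteq> {}" using subspace_0[OF subY] by (auto simp: Y_def closed_span_def)
  ultimately obtain k v0 d where v0: "v0 \<in> Y" and d: "d > 0" "Y \<inter> ball v0 d \<subseteq> closure (A k)"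
    using Baire_closed_cover[of Y A] by blast
  have near: "\<exists>w a. E a (2 * real k) w \<and> norm (v - w) < e" if v: "v \<in> Y" "norm v < d" and e: "e > 0" for v e
  proof -
    have "v0 + v \<in> closure (A k)" "v0 \<in> closure (A k)"
      using d v v0 subY by (auto simp: subset_iff dist_norm subspace_add)
    then obtain p q where pq: "p \<in> A k" "dist p (v0 + v) < e / 2" "q \<in> A k" "dist q v0 < e / 2"
      using e unfolding closure_approachable by (meson half_gt_zero)
    obtain a b where ab: "E a (real k) p" "E b (real k) q" using pq by (auto simp: A_def)
    have "E (\<lambda>i. a i - b i) (2 * real k) (p - q)"
      unfolding E_def
    proof (intro conjI allI)
      show "(\<lambda>n. (a n - b n) *\<^sub>R u n) sums (p - q)"
        using ab by (auto simp: E_def scaleR_left_diff_distrib intro: sums_diff)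
      fix n
      have "norm (\<Sum>k<n. a k *\<^sub>R u k) \<le> real k" "norm (\<Sum>k<n. b k *\<^sub>R u k) \<le> real k"
        using ab by (auto simp: E_def)
      then show "norm (\<Sum>k<n. (a k - b k) *\<^sub>R u k) \<le> 2 * real k"
        using norm_triangle_ineq4[of "\<Sum>k<n. a k *\<^sub>R u k" "\<Sum>k<n. b k *\<^sub>R u k"]
        by (simp add: scaleR_left_diff_distrib sum_subtractf)
    qed
    moreover have "norm (v - (p - q)) < e"
    proof -
      have "v - (p - q) = (q - v0) - (p - (v0 + v))" by simp
      then have "norm (v - (p - q)) \<le> norm (q - v0) + norm (p - (v0 + v))"
        using norm_triangle_ineq4 by metis
      then show ?thesis using pq by (simp add: dist_norm)
    qed
    ultimately show ?thesis by blast
  qed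
  define C where "C = 4 * real k / d"
  have C: "C \<ge> 0" using d by (simp add: C_def)
  have halve: "\<exists>w a. E a (C * norm v) w \<and> norm (v - w) \<le> norm v / 2" if v: "v \<in> Y" for v
  proof (cases "v = 0")
    case True
    then show ?thesis by (intro exI[of _ 0] exI[of _ "\<lambda>_. 0"]) (simp add: E_def)
  next
    case False
    define t where "t = d / (2 * norm v)"
    have t: "t > 0" "t * norm v = d / 2" "inverse t * (2 * real k) = C * norm v" "inverse t * (d / 4) = norm v / 2"
      using False d by (auto simp: t_def C_def field_simps)
    have "t *\<^sub>R v \<in> Y" "norm (t *\<^sub>R v) < d" "d / 4 > 0" using v subY t d by (auto simp: subspace_scale)
    from near[OF this] obtain w a where w: "E a (2 * real k) w" "norm (t *\<^sub>R v - w) < d / 4" by blast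
    have "E (\<lambda>i. inverse t * a i) (C * norm v) (inverse t *\<^sub>R w)"
      unfolding E_def
    proof (intro conjI allI)
      show "(\<lambda>n. (inverse t * a n) *\<^sub>R u n) sums (inverse t *\<^sub>R w)"
        using w(1) sums_scaleR_right[of "\<lambda>n. a n *\<^sub>R u n" w "inverse t"] by (simp add: E_def)
      fix n
      have "(\<Sum>k<n. (inverse t * a k) *\<^sub>R u k) = inverse t *\<^sub>R (\<Sum>k<n. a k *\<^sub>R u k)"
        by (simp add: scaleR_sum_right)
      moreover have "norm (\<Sum>k<n. a k *\<^sub>R u k) \<le> 2 * real k" using w(1) by (simp add: E_def)
      then have "inverse t * norm (\<Sum>k<n. a k *\<^sub>R u k) \<le> inverse t * (2 * real k)"
        using t(1) by (intro mult_left_mono) auto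
      ultimately show "norm (\<Sum>k<n. (inverse t * a k) *\<^sub>R u k) \<le> C * norm v"
        using t(1) unfolding t(3) by simp
    qed
    moreover have "norm (v - inverse t *\<^sub>R w) \<le> norm v / 2"
    proof -
      have "v - inverse t *\<^sub>R w = inverse t *\<^sub>R (t *\<^sub>R v - w)"
      using t(1) by (simp add: scaleR_right_diff_distrib)
      then have "norm (v - inverse t *\<^sub>R w) = inverse t * norm (t *\<^sub>R v - w)" using t(1) by simp
      also have "\<dots> \<le> inverse t * (d / 4)" using w(2) t(1) by (intro mult_left_mono) auto
      finally show ?thesis unfolding t(4) .
    qed
    ultimately show ?thesis by blast
  qed
  have expand: "\<exists>b. E b (2 * C * norm v) v" if v: "v \<in> Y" for v
  proof -
    obtain W where "\<And>x. x \<in> Y \<Longrightarrow> \<exists>a. E a (C * norm x) (W x) \<and> norm (x - W x) \<le> norm x / 2"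
      using halve by metis
    then obtain \<alpha> where W: "\<And>x. x \<in> Y \<Longrightarrow> E (\<alpha> x) (C * norm x) (W x)"
      "\<And>x. x \<in> Y \<Longrightarrow> norm (x - W x) \<le> norm x / 2" by metis
    \<comment> \<open>\<open>R i\<close> is what remains of \<open>v\<close> after \<open>i\<close> approximation steps\<close>
    define R where "R = (\<lambda>i. ((\<lambda>x. x - W x) ^^ i) v)"
    have R: "R 0 = v" "R (Suc i) = R i - W (R i)" for i by (auto simp: R_def)
    have RY: "R i \<in> Y" for i
      by (induction i) (use v subY EY W(1) in \<open>auto simp: R intro!: subspace_diff\<close>)
    have Rn: "norm (R i) \<le> norm v * (1/2) ^ i" for i
    proof (induction i)
      case (Suc i)
      then show ?case using W(2)[OF RY, of i] by (simp add: R)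
    qed (simp add: R)
    have RW: "v - (\<Sum>i<I. W (R i)) = R I" for I
      by (induction I) (simp_all add: R algebra_simps)
    define S where "S = (\<lambda>i n. \<Sum>k<n. \<alpha> (R i) k *\<^sub>R u k)"
    define M where "M = (\<lambda>i. C * norm v * (1/2) ^ i)"
    have SM: "norm (S i n) \<le> M i" for i n
    proof -
      have "norm (S i n) \<le> C * norm (R i)" using W(1)[OF RY, of i] by (simp add: E_def S_def)
      also have "\<dots> \<le> M i" using mult_left_mono[OF Rn[of i] C] by (simp add: M_def mult.assoc)
      finally show ?thesis .
    qed
    have SW: "S i \<longlonglongrightarrow> W (R i)" for i
      using W(1)[OF RY, of i] by (simp add: E_def S_def sums_def)
    have M0: "M i \<ge> 0" for i using SM[of i 0] by (simp add: S_def)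
    have sumM: "M sums (2 * C * norm v)"
      using sums_mult[OF geometric_sums[of "1/2::real"], of "C * norm v"] by (simp add: M_def mult_ac)
    define b where "b = (\<lambda>k. \<Sum>i. \<alpha> (R i) k)"
    have b: "summable (\<lambda>i. \<alpha> (R i) k)" for k
    proof (rule summable_comparison_test')
      show "summable (\<lambda>i. 2 / norm (u k) * M i)" using sumM by (intro summable_mult) (rule sums_summable)
      fix i
      have "\<alpha> (R i) k *\<^sub>R u k = S i (Suc k) - S i k" by (simp add: S_def)
      then have "\<bar>\<alpha> (R i) k\<bar> * norm (u k) \<le> 2 * M i"
        using norm_triangle_ineq4[of "S i (Suc k)" "S i k"] SM[of i k] SM[of i "Suc k"]
        by (metis add_mono mult_2 norm_scaleR order_trans)
      then show "norm (\<alpha> (R i) k) \<le> 2 / norm (u k) * M i"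
        using basic_sequence_nonzero[OF u, of k] by (simp add: field_simps)
    qed
    have Ssum: "summable (\<lambda>i. S i n)" for n
      by (rule summable_comparison_test'[OF sums_summable[OF sumM]]) (rule SM)
    define T where "T = (\<lambda>n. \<Sum>k<n. b k *\<^sub>R u k)"
    have T: "T n = (\<Sum>i. S i n)" for n
    proof -
      have "T n = (\<Sum>k<n. \<Sum>i. \<alpha> (R i) k *\<^sub>R u k)"
        unfolding T_def b_def by (intro sum.cong refl suminf_scaleR_left b)
      also have "\<dots> = (\<Sum>i. S i n)"
        unfolding S_def by (rule suminf_sum[symmetric]) (intro summable_scaleR_left b)
      finally show ?thesis .
    qed
    have tail: "norm (T n - (\<Sum>i<I. S i n)) \<le> 2 * M I" for n I
    proof -
      have "T n - (\<Sum>i<I. S i n) = (\<Sum>i. S (i + I) n)"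
        using suminf_split_initial_segment[OF Ssum, of n I] by (simp add: T)
      also have "norm \<dots> \<le> (\<Sum>i. M (i + I))"
        by (rule norm_suminf_le[OF SM]) (use sumM in \<open>simp add: summable_iff_shift sums_summable\<close>)
      also have "(\<lambda>i. M (i + I)) sums (2 * M I)"
        using sums_mult[OF geometric_sums[of "1/2::real"], of "M I"] by (simp add: M_def power_add mult_ac)
      then have "(\<Sum>i. M (i + I)) = 2 * M I" by (simp add: sums_iff)
      finally show ?thesis .
    qed
    have bound: "norm (T n) \<le> 2 * C * norm v" for n
      using tail[of n 0] by (simp add: M_def)
    have "T \<longlonglongrightarrow> v"
    proof (rule LIMSEQ_I)
      fix e :: real assume e: "0 < e"
      have "M \<longlonglongrightarrow> 0" using sumM by (intro summable_LIMSEQ_zero) (rule sums_summable)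
      moreover have "(\<lambda>i. norm v * (1/2) ^ i) \<longlonglongrightarrow> 0"
        by (intro tendsto_mult_right_zero LIMSEQ_power_zero) simp
      ultimately have "(\<lambda>i. 2 * M i + norm v * (1/2) ^ i) \<longlonglongrightarrow> 2 * 0 + 0" by (intro tendsto_intros)
      then have "eventually (\<lambda>i. 2 * M i + norm v * (1/2) ^ i < e / 2) sequentially"
        using e by (intro order_tendstoD(2)) auto
      then obtain I where I: "2 * M I + norm v * (1/2) ^ I < e / 2" by (auto simp: eventually_sequentially)
      have "(\<lambda>n. \<Sum>i<I. S i n) \<longlonglongrightarrow> (\<Sum>i<I. W (R i))" by (intro tendsto_sum SW)
      then obtain N where N: "\<And>n. n \<ge> N \<Longrightarrow> norm ((\<Sum>i<I. S i n) - (\<Sum>i<I. W (R i))) < e / 2"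
        using LIMSEQ_D[of _ _ "e / 2"] e by (metis half_gt_zero)
      have "norm (T n - v) < e" if "n \<ge> N" for n
      proof -
        have "T n - v = (T n - (\<Sum>i<I. S i n)) + ((\<Sum>i<I. S i n) - (\<Sum>i<I. W (R i))) - R I"
          using RW[of I] by (simp add: algebra_simps)
        then have "norm (T n - v) \<le> norm (T n - (\<Sum>i<I. S i n)) + norm ((\<Sum>i<I. S i n) - (\<Sum>i<I. W (R i))) + norm (R I)"
          by (metis norm_triangle_ineq norm_triangle_le_diff add_mono order_refl)
        then show ?thesis using tail[of n I] N[OF that] Rn[of I] I by linarith
      qed
      then show "\<exists>N. \<forall>n\<ge>N. norm (T n - v) < e" by blast
    qed
    then have "E b (2 * C * norm v) v" using bound by (simp add: E_def sums_def T_def)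
    then show ?thesis by blast
  qed
  have main: "norm (\<Sum>k<m. a k *\<^sub>R u k) \<le> (2 * C + 1) * norm (\<Sum>k<n. a k *\<^sub>R u k)" if mn: "m \<le> n" for a and m n :: nat
  proof -
    let ?v = "\<Sum>k<n. a k *\<^sub>R u k"
    let ?a = "\<lambda>k. if k < n then a k else 0"
    have "?v \<in> span (range u)" by (intro span_sum span_scale span_base) auto
    then have vY: "?v \<in> Y" unfolding Y_def closed_span_def using closure_subset by blast
    then obtain b where b: "E b (2 * C * norm ?v) ?v" using expand by blast
    have "(\<lambda>k. ?a k *\<^sub>R u k) sums (\<Sum>k<n. ?a k *\<^sub>R u k)" by (rule sums_finite) auto
    also have "(\<Sum>k<n. ?a k *\<^sub>R u k) = ?v" by (rule sum.cong) auto
    finally have "(\<lambda>k. ?a k *\<^sub>R u k) sums ?v" .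
    moreover have "(\<lambda>k. b k *\<^sub>R u k) sums ?v" using b by (simp add: E_def)
    ultimately have "?a = b" by (rule basic_sequence_coefficients_unique[OF u vY[unfolded Y_def]])
    then have "b = ?a" by (rule sym)
    then have "norm (\<Sum>k<m. ?a k *\<^sub>R u k) \<le> 2 * C * norm ?v" using b by (simp add: E_def)
    moreover have "(\<Sum>k<m. ?a k *\<^sub>R u k) = (\<Sum>k<m. a k *\<^sub>R u k)" using mn by (intro sum.cong) auto
    ultimately show ?thesis by (simp add: distrib_right add_increasing2)
  qed
  show ?thesis by (rule exI[of _ "2 * C + 1"]) (use main C in auto)
qed

section \<open>Blocks of unconditional basic sequences\<close>

lemma summable_on_small_tails:
  fixes f :: "nat \<Rightarrow> 'a::real_normed_vector"
  assumes "f summable_on UNIV" "e > 0"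
  shows "\<exists>N. \<forall>F. finite F \<and> F \<subseteq> {N..} \<longrightarrow> norm (sum f F) < e"
proof -
  obtain L where "(f has_sum L) UNIV" using assms(1) by (auto simp: summable_on_def)
  then have "eventually (\<lambda>F. dist (sum f F) L < e / 2) (finite_subsets_at_top UNIV)"
    using assms(2) unfolding has_sum_def by (intro tendstoD) auto
  then obtain F0 where F0: "finite F0" "\<And>F. finite F \<Longrightarrow> F0 \<subseteq> F \<Longrightarrow> dist (sum f F) L < e / 2"
    by (auto simp: eventually_finite_subsets_at_top)
  obtain N where N: "F0 \<subseteq> {..<N}" using F0(1) finite_nat_bounded by blast
  have "norm (sum f F) < e" if F: "finite F" "F \<subseteq> {N..}" for F
  proof -
    have "F0 \<inter> F = {}" using N F(2) by fastforce
    then have "sum f F = sum f (F0 \<union> F) - sum f F0" using F0(1) F(1) by (simp add: sum.union_disjoint)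
    then have "norm (sum f F) = dist (sum f (F0 \<union> F)) (sum f F0)" by (simp add: dist_norm)
    also have "\<dots> \<le> dist (sum f (F0 \<union> F)) L + dist (sum f F0) L" by (rule dist_triangle2)
    finally show ?thesis using F0(2)[of "F0 \<union> F"] F0(2)[of F0] F0(1) F(1) by simp
  qed
  then show ?thesis by blast
qed

lemma sum_blocks:
  fixes N :: "nat \<Rightarrow> nat"
  assumes "mono N" "i \<le> j"
  shows "sum f {N i..<N j} = (\<Sum>l=i..<j. sum f {N l..<N (Suc l)})"
  using assms(2)
proof (induction rule: dec_induct)
  case (step j)
  have "sum f {N i..<N j} + sum f {N j..<N (Suc j)} = sum f {N i..<N (Suc j)}"
    using assms(1) step by (intro sum.atLeastLessThan_concat) (auto simp: mono_def)
  then show ?case using step by simp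
qed simp

text \<open>The block sums are absolutely summable, and by the basis constant so small that the series
  \<open>\<Sum>a k u k\<close> itself converges.  It then converges unconditionally, so sums over finite sets far out are
  small; apply this to the indices with positive and with negative coefficients of one block.\<close>

theorem unconditional_blocks_abs_tendsto_zero:
  fixes u :: "nat \<Rightarrow> 'a::banach"
  assumes u: "unconditional_basic_sequence u" and N: "strict_mono N"
    and small: "summable (\<lambda>j. norm (\<Sum>k=N j..<N (Suc j). a k *\<^sub>R u k))"
  shows "(\<lambda>j. \<Sum>k=N j..<N (Suc j). \<bar>a k\<bar> *\<^sub>R u k) \<longlonglongrightarrow> 0"
proof -
  define \<beta> where "\<beta> = (\<lambda>j. \<Sum>k=N j..<N (Suc j). a k *\<^sub>R u k)"
  obtain K where K: "K > 0" "\<And>a m n. m \<le> n \<Longrightarrow> norm (\<Sum>k<m. a k *\<^sub>R u k) \<le> K * norm (\<Sum>k<n. a k *\<^sub>R u k)"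
    using basis_constant[of u] u unfolding unconditional_basic_sequence_def by metis
  have part: "norm (\<Sum>k=N J..<n. a k *\<^sub>R u k) \<le> K * (\<Sum>j=J..<n. norm (\<beta> j))" if n: "N J \<le> n" for J n
  proof -
    have Jn: "J \<le> n" "n \<le> N n" using n strict_mono_imp_increasing[OF N, of J] strict_mono_imp_increasing[OF N, of n] by linarith+
    let ?c = "\<lambda>k. if k < N J then 0 else a k"
    have cut: "(\<Sum>k<m. ?c k *\<^sub>R u k) = (\<Sum>k=N J..<m. a k *\<^sub>R u k)" for m
      by (rule sum.mono_neutral_cong_right) auto
    have "norm (\<Sum>k=N J..<n. a k *\<^sub>R u k) \<le> K * norm (\<Sum>k=N J..<N n. a k *\<^sub>R u k)"
      using K(2)[OF Jn(2), of ?c] by (simp only: cut)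
    also have "(\<Sum>k=N J..<N n. a k *\<^sub>R u k) = (\<Sum>j=J..<n. \<beta> j)"
      unfolding \<beta>_def using N Jn(1) by (intro sum_blocks strict_mono_mono)
    also have "K * norm \<dots> \<le> K * (\<Sum>j=J..<n. norm (\<beta> j))"
      using K(1) by (intro mult_left_mono norm_sum) auto
    finally show ?thesis .
  qed
  have "summable (\<lambda>k. a k *\<^sub>R u k)"
    unfolding summable_Cauchy
  proof (intro allI impI)
    fix e :: real assume e: "0 < e"
    then have "0 < e / (2 * K)" using K(1) by simp
    then obtain J where J: "\<And>n. norm (\<Sum>j=J..<n. norm (\<beta> j)) < e / (2 * K)"
      using small unfolding summable_Cauchy \<beta>_def by (meson order_refl)
    have half: "norm (\<Sum>k=N J..<n. a k *\<^sub>R u k) < e / 2" if "N J \<le> n" for n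
    proof -
      have "K * (\<Sum>j=J..<n. norm (\<beta> j)) < K * (e / (2 * K))"
        using J[of n] K(1) by (intro mult_strict_left_mono) auto
      then show ?thesis using part[OF that] K(1) by simp
    qed
    have "norm (\<Sum>k=m..<n. a k *\<^sub>R u k) < e" if m: "N J \<le> m" for m n
    proof (cases "m \<le> n")
      case True
      then have "(\<Sum>k=m..<n. a k *\<^sub>R u k) = (\<Sum>k=N J..<n. a k *\<^sub>R u k) - (\<Sum>k=N J..<m. a k *\<^sub>R u k)"
        using sum.atLeastLessThan_concat[OF m True, of "\<lambda>k. a k *\<^sub>R u k"] by (simp add: algebra_simps)
      then have "norm (\<Sum>k=m..<n. a k *\<^sub>R u k) \<le> norm (\<Sum>k=N J..<n. a k *\<^sub>R u k) + norm (\<Sum>k=N J..<m. a k *\<^sub>R u k)"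
        by (metis norm_triangle_ineq4)
      then show ?thesis using half[of n] half[of m] m True by linarith
    qed (use e in simp)
    then show "\<exists>M. \<forall>m\<ge>M. \<forall>n. norm (\<Sum>k=m..<n. a k *\<^sub>R u k) < e" by blast
  qed
  then have sum_on: "(\<lambda>k. a k *\<^sub>R u k) summable_on UNIV"
    using u by (auto simp: unconditional_basic_sequence_def)
  show ?thesis
  proof (rule LIMSEQ_I)
    fix e :: real assume e: "0 < e"
    have "\<exists>m. \<forall>F. finite F \<and> F \<subseteq> {m..} \<longrightarrow> norm (\<Sum>k\<in>F. a k *\<^sub>R u k) < e / 2"
      using e by (intro summable_on_small_tails sum_on) simp
    then obtain m where m: "\<forall>F. finite F \<and> F \<subseteq> {m..} \<longrightarrow> norm (\<Sum>k\<in>F. a k *\<^sub>R u k) < e / 2" ..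
    have "norm (\<Sum>k=N j..<N (Suc j). \<bar>a k\<bar> *\<^sub>R u k) < e" if "m \<le> j" for j
    proof -
      let ?F = "{N j..<N (Suc j)}"
      have mj: "m \<le> N j" using that strict_mono_imp_increasing[OF N, of j] by simp
      have "(\<Sum>k\<in>?F. \<bar>a k\<bar> *\<^sub>R u k) = (\<Sum>k\<in>{k\<in>?F. 0 \<le> a k}. a k *\<^sub>R u k) - (\<Sum>k\<in>{k\<in>?F. \<not> 0 \<le> a k}. a k *\<^sub>R u k)"
        unfolding sum.inter_filter[OF finite_atLeastLessThan] sum_subtractf[symmetric]
        by (rule sum.cong) auto
      then have "norm (\<Sum>k\<in>?F. \<bar>a k\<bar> *\<^sub>R u k) \<le>
          norm (\<Sum>k\<in>{k\<in>?F. 0 \<le> a k}. a k *\<^sub>R u k) + norm (\<Sum>k\<in>{k\<in>?F. \<not> 0 \<le> a k}. a k *\<^sub>R u k)"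
        by (simp only: norm_triangle_ineq4)
      moreover have "norm (\<Sum>k\<in>{k\<in>?F. 0 \<le> a k}. a k *\<^sub>R u k) < e / 2"
        by (rule m[rule_format]) (use mj in auto)
      moreover have "norm (\<Sum>k\<in>{k\<in>?F. \<not> 0 \<le> a k}. a k *\<^sub>R u k) < e / 2"
        by (rule m[rule_format]) (use mj in auto)
      ultimately show ?thesis by linarith
    qed
    then show "\<exists>M. \<forall>j\<ge>M. norm ((\<Sum>k=N j..<N (Suc j). \<bar>a k\<bar> *\<^sub>R u k) - 0) < e" by auto
  qed
qed

section \<open>From disjoint to positive disjoint sequences\<close>

lemma sum_scaleR_factor:
  "(\<Sum>k\<in>F. (t * a k) *\<^sub>R y k) = t *\<^sub>R (\<Sum>k\<in>F. a k *\<^sub>R (y k :: 'a::real_vector))"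
  by (simp add: scaleR_sum_right)

lemma sum_scaleR_cong:
  "(\<And>k. k \<in> F \<Longrightarrow> a k = b k) \<Longrightarrow> (\<Sum>k\<in>F. a k *\<^sub>R y k) = (\<Sum>k\<in>F. b k *\<^sub>R (y k :: 'a::real_vector))"
  by (rule sum.cong) simp_all

lemma sum_scaleR_shift:
  fixes y :: "nat \<Rightarrow> 'a::real_vector"
  shows "(\<Sum>k<n. a k *\<^sub>R y (k + M)) = (\<Sum>k=M..<n + M. a (k - M) *\<^sub>R y k)"
  using sum.shift_bounds_nat_ivl[of "\<lambda>k. a (k - M) *\<^sub>R y k" 0 M n] by (simp add: atLeast0LessThan)

lemma sum_scaleR_single:
  fixes y :: "nat \<Rightarrow> 'a::real_vector"
  shows "N \<le> n \<Longrightarrow> (\<Sum>k=N..<Suc n. (if k = n then 1 else 0) *\<^sub>R y k) = y n"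
  using sum.remove[of "{N..<Suc n}" n "\<lambda>k. (if k = n then 1 else 0) *\<^sub>R y k"] by simp

lemma sum_scaleR_cut:
  fixes y :: "nat \<Rightarrow> 'a::real_vector"
  shows "M \<le> N \<Longrightarrow> (\<Sum>k=M..<n. (if k < N then 0 else b k) *\<^sub>R y k) = (\<Sum>k=N..<n. b k *\<^sub>R y k)"
  by (rule sum.mono_neutral_cong_right) auto

text \<open>Used for positive parts, \<open>p k = (x k)\<^sup>+\<close>, and for changes of sign of the coefficients.\<close>

lemma norm_sum_mono_disjoint:
  fixes x p :: "nat \<Rightarrow> 'a::banach_lattice"
  assumes "finite F" "\<And>m n. m \<noteq> n \<Longrightarrow> disjoint_vec (x m) (x n)"
    and le: "\<And>k. k \<in> F \<Longrightarrow> \<bar>b k\<bar> \<le> \<bar>a k\<bar>" "\<And>k. k \<in> F \<Longrightarrow> \<bar>p k\<bar> \<le> \<bar>x k\<bar>"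
  shows "norm (\<Sum>k\<in>F. b k *\<^sub>R p k) \<le> norm (\<Sum>k\<in>F. a k *\<^sub>R x k)"
proof (rule norm_lattice_mono)
  have "\<bar>\<Sum>k\<in>F. b k *\<^sub>R p k\<bar> \<le> (\<Sum>k\<in>F. \<bar>b k *\<^sub>R p k\<bar>)"
    using assms(1) by (induction F rule: finite_induct) (auto intro: order_trans[OF abs_triangle_ineq] add_left_mono)
  also have "\<dots> \<le> (\<Sum>k\<in>F. \<bar>a k *\<^sub>R x k\<bar>)"
    unfolding abs_scaleR using le by (intro sum_mono scaleR_mono) auto
  also have "\<dots> = \<bar>\<Sum>k\<in>F. a k *\<^sub>R x k\<bar>"
    by (rule abs_sum_disjoint[symmetric])
      (auto intro!: disjoint_vec_scaleR disjoint_vec_commute[OF disjoint_vec_scaleR] assms)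
  finally show "\<bar>\<Sum>k\<in>F. b k *\<^sub>R p k\<bar> \<le> \<bar>\<Sum>k\<in>F. a k *\<^sub>R x k\<bar>" .
qed

lemma disjoint_vec_pprt: "disjoint_vec x y \<Longrightarrow> disjoint_vec (pprt x) (pprt y)"
  by (erule disjoint_vec_mono) (rule abs_pprt_le)+

lemma disjoint_vec_uminus: "disjoint_vec x y \<Longrightarrow> disjoint_vec (- x) (- y)"
  by (simp add: disjoint_vec_def)

lemma not_LSS_if_l1_lower_bound:
  fixes T :: "'a::banach_lattice \<Rightarrow> 'b::banach" and y :: "nat \<Rightarrow> 'a"
  assumes T: "bounded_linear T" and y: "\<And>n. 0 \<le> y n" "\<And>n. norm (y n) \<le> 1" "\<And>m n. m \<noteq> n \<Longrightarrow> disjoint_vec (y m) (y n)"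
    and d: "d > 0" "\<And>a n. d * (\<Sum>k<(n::nat). \<bar>a k\<bar>) \<le> norm (\<Sum>k<n. a k *\<^sub>R T (y k))"
  shows "\<not> LSS T"
proof (rule not_LSS_if_lower_bound[OF T y(1) _ y(3) d(1)])
  show "y n \<noteq> 0" for n
  proof
    assume "y n = 0"
    then have "T (y n) = 0" using T by (simp add: linear_simps)
    let ?a = "\<lambda>k. if k = n then 1 else 0 :: real"
    have "(\<Sum>k<Suc n. \<bar>?a k\<bar>) = 1" by simp
    moreover have "(\<Sum>k<Suc n. ?a k *\<^sub>R T (y k)) = 0"
      using \<open>T (y n) = 0\<close> by (intro sum.neutral) auto
    ultimately show False using d(2)[of ?a "Suc n"] d(1) by simp
  qed
  fix a and n :: nat
  have "norm (\<Sum>k<n. a k *\<^sub>R y k) \<le> (\<Sum>k<n. \<bar>a k\<bar>)"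
    using y(2) by (intro order_trans[OF norm_sum] sum_mono) (simp add: mult_left_le)
  then have "d * norm (\<Sum>k<n. a k *\<^sub>R y k) \<le> d * (\<Sum>k<n. \<bar>a k\<bar>)"
    using d(1) by (intro mult_left_mono) auto
  also have "\<dots> \<le> norm (\<Sum>k<n. a k *\<^sub>R T (y k))" by (rule d(2))
  finally show "d * norm (\<Sum>k<n. a k *\<^sub>R y k) \<le> norm (\<Sum>k<n. a k *\<^sub>R T (y k))" .
qed

text \<open>On the span of the \<open>z j\<close> the operator is bounded below and almost kills the positive parts, so it is
  bounded below on the negative parts.\<close>

lemma not_LSS_if_positive_parts_small:
  fixes T :: "'a::banach_lattice \<Rightarrow> 'b::banach" and z :: "nat \<Rightarrow> 'a"
  assumes T: "bounded_linear T" and z: "\<And>j. norm (z j) = 1" "\<And>m n. m \<noteq> n \<Longrightarrow> disjoint_vec (z m) (z n)"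
    and c: "c > 0" "\<And>v. v \<in> span (range z) \<Longrightarrow> c * norm v \<le> norm (T v)"
    and small: "\<And>j. norm (T (pprt (z j))) \<le> c / 4 * (1 / 2) ^ j"
  shows "\<not> LSS T"
proof (rule not_LSS_if_lower_bound[OF T, of "\<lambda>j. pprt (- z j)" "c / 2"])
  interpret T: bounded_linear T by fact
  have Tz: "T (pprt (- z j)) = T (pprt (z j)) - T (z j)" for j
    using pprt_minus_pprt_uminus[of "z j"] by (metis T.diff diff_diff_eq2 add_diff_cancel_left' add.commute)
  show "pprt (- z j) \<noteq> 0" for j
  proof
    assume "pprt (- z j) = 0"
    then have "norm (T (z j)) = norm (T (pprt (z j)))" using Tz[of j] T.zero by simp
    moreover have "c \<le> norm (T (z j))" using c(2)[of "z j"] z(1)[of j] by (auto simp: span_base)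
    moreover have "c / 4 * (1 / 2) ^ j \<le> c / 4" using c(1) by (simp add: power_le_one)
    ultimately show False using small[of j] c(1) by linarith
  qed
  show "disjoint_vec (pprt (- z m)) (pprt (- z n))" if "m \<noteq> n" for m n
    using z(2)[OF that] by (intro disjoint_vec_pprt disjoint_vec_uminus)
  show "0 < c / 2" using c(1) by simp
  fix b and n :: nat
  let ?v = "\<Sum>k<n. b k *\<^sub>R z k"
  \<comment> \<open>Each \<open>\<bar>b k\<bar>\<close> is at most \<open>\<parallel>\<Sum>b k z k\<parallel>\<close>, and the bounds \<open>c / 4 \<cdot> 2\<^sup>-\<^sup>k\<close> add up to at most \<open>c / 2\<close>.\<close>
  have "norm (\<Sum>k<n. b k *\<^sub>R T (pprt (z k))) \<le> (\<Sum>k<n. norm ?v * (c / 4 * (1 / 2) ^ k))"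
  proof (intro order_trans[OF norm_sum] sum_mono)
    fix k assume "k \<in> {..<n}"
    then have "\<bar>b k\<bar> \<le> norm ?v" using norm_le_norm_sum_disjoint[of "{..<n}" z k b] z by simp
    then show "norm (b k *\<^sub>R T (pprt (z k))) \<le> norm ?v * (c / 4 * (1 / 2) ^ k)"
      unfolding norm_scaleR using small[of k] by (intro mult_mono) auto
  qed
  also have "\<dots> = norm ?v * (c / 4) * (\<Sum>k<n. (1 / 2) ^ k)" by (simp add: sum_distrib_left mult.assoc)
  also have "(\<Sum>k<n. (1 / 2 :: real) ^ k) \<le> 2" by (simp add: sum_gp_strict)
  then have "norm ?v * (c / 4) * (\<Sum>k<n. (1 / 2) ^ k) \<le> norm ?v * (c / 4) * 2"
    using c(1) by (intro mult_left_mono) auto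
  finally have 1: "norm (\<Sum>k<n. b k *\<^sub>R T (pprt (z k))) \<le> c / 2 * norm ?v" by (simp add: mult.commute)
  have "?v \<in> span (range z)" by (intro span_sum span_scale span_base) auto
  then have 2: "c * norm ?v \<le> norm (\<Sum>k<n. b k *\<^sub>R T (z k))"
    using c(2) by (metis (no_types, lifting) T.scaleR T.sum sum.cong)
  have "norm (\<Sum>k<n. b k *\<^sub>R pprt (- z k)) \<le> norm ?v"
    using z(2) abs_pprt_le[of "- z _"] by (intro norm_sum_mono_disjoint) auto
  then have 3: "c / 2 * norm (\<Sum>k<n. b k *\<^sub>R pprt (- z k)) \<le> c / 2 * norm ?v"
    using c(1) by (intro mult_left_mono) auto
  have "(\<Sum>k<n. b k *\<^sub>R T (z k)) = (\<Sum>k<n. b k *\<^sub>R T (pprt (z k))) - (\<Sum>k<n. b k *\<^sub>R T (pprt (- z k)))"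
    by (simp add: Tz scaleR_right_diff_distrib sum_subtractf)
  then have "norm (\<Sum>k<n. b k *\<^sub>R T (z k)) \<le> norm (\<Sum>k<n. b k *\<^sub>R T (pprt (z k))) + norm (\<Sum>k<n. b k *\<^sub>R T (pprt (- z k)))"
    by (metis norm_triangle_ineq4)
  then show "c / 2 * norm (\<Sum>k<n. b k *\<^sub>R pprt (- z k)) \<le> norm (\<Sum>k<n. b k *\<^sub>R T (pprt (- z k)))"
    using 1 2 3 by simp
qed simp

text \<open>Coefficients chosen separately on successive intervals are glued to a single sequence, since \<open>P\<close> only
  sees the coefficients on its interval.\<close>

lemma successive_blocks:
  fixes P :: "nat \<Rightarrow> nat \<Rightarrow> nat \<Rightarrow> (nat \<Rightarrow> 'b) \<Rightarrow> bool"
  assumes ex: "\<And>j N. \<exists>n>N. \<exists>a. P j N n a"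
    and cong: "\<And>j N n a b. P j N n a \<Longrightarrow> (\<And>k. N \<le> k \<Longrightarrow> k < n \<Longrightarrow> a k = b k) \<Longrightarrow> P j N n b"
  shows "\<exists>N a. strict_mono N \<and> N 0 = N0 \<and> (\<forall>j. P j (N j) (N (Suc j)) a)"
proof -
  define \<nu> where "\<nu> = (\<lambda>j N. SOME n. N < n \<and> (\<exists>a. P j N n a))"
  define \<alpha> where "\<alpha> = (\<lambda>j N. SOME a. P j N (\<nu> j N) a)"
  have "N < \<nu> j N \<and> (\<exists>a. P j N (\<nu> j N) a)" for j N
    unfolding \<nu>_def using ex[of N j] by (rule someI_ex)
  then have \<nu>: "N < \<nu> j N \<and> P j N (\<nu> j N) (\<alpha> j N)" for j N
    unfolding \<alpha>_def by (metis someI_ex)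
  define N where "N = rec_nat N0 \<nu>"
  have N: "N 0 = N0" "N (Suc j) = \<nu> j (N j)" for j by (simp_all add: N_def)
  have mono: "strict_mono N" unfolding strict_mono_Suc_iff using \<nu> by (simp add: N)
  define a where "a = (\<lambda>k. let j = (LEAST j. k < N (Suc j)) in \<alpha> j (N j) k)"
  have "P j (N j) (N (Suc j)) a" for j
  proof (rule cong)
    show "P j (N j) (N (Suc j)) (\<alpha> j (N j))" using \<nu> by (simp add: N(2))
    fix k assume k: "N j \<le> k" "k < N (Suc j)"
    have "(LEAST j. k < N (Suc j)) = j"
    proof (rule Least_equality)
      fix i assume "k < N (Suc i)"
      then have "N j < N (Suc i)" using k by simp
      then show "j \<le> i" using strict_mono_less[OF mono] by simp
    qed (rule k)
    then show "\<alpha> j (N j) k = a k" by (simp add: a_def)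
  qed
  then show ?thesis using mono N(1) by blast
qed

text \<open>Since the coefficients are nonnegative, the positive part of \<open>\<Sum>a k x k\<close> is \<open>\<Sum>a k (x k)\<^sup>+\<close>.  So normalised
  successive blocks have small images of their positive parts.\<close>

lemma not_LSS_if_small_on_positive_combinations:
  fixes T :: "'a::banach_lattice \<Rightarrow> 'b::banach" and x :: "nat \<Rightarrow> 'a"
  assumes T: "bounded_linear T" and x: "\<And>m n. m \<noteq> n \<Longrightarrow> disjoint_vec (x m) (x n)"
    and c: "c > 0" "\<And>v. v \<in> span (range x) \<Longrightarrow> c * norm v \<le> norm (T v)"
    and small: "\<And>N e. e > 0 \<Longrightarrow> \<exists>n a. (\<forall>k. 0 \<le> a k) \<and>
      norm (\<Sum>k=N..<n. a k *\<^sub>R T (pprt (x k))) < e * norm (\<Sum>k=N..<n. a k *\<^sub>R x k)"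
  shows "\<not> LSS T"
proof -
  interpret T: bounded_linear T by fact
  define P where "P = (\<lambda>j N n a. (\<forall>k\<in>{N..<n}. 0 \<le> a k) \<and> norm (\<Sum>k=N..<n. a k *\<^sub>R x k) = 1 \<and>
    norm (\<Sum>k=N..<n. a k *\<^sub>R T (pprt (x k))) \<le> c / 4 * (1 / 2) ^ j)"
  have "\<exists>N a. strict_mono N \<and> N 0 = 0 \<and> (\<forall>j. P j (N j) (N (Suc j)) a)"
  proof (rule successive_blocks)
    fix j N :: nat
    let ?e = "c / 4 * (1 / 2) ^ j"
    have "?e > 0" using c(1) by simp
    from small[OF this, of N] obtain n a where a: "\<And>k. 0 \<le> a k"
      "norm (\<Sum>k=N..<n. a k *\<^sub>R T (pprt (x k))) < ?e * norm (\<Sum>k=N..<n. a k *\<^sub>R x k)" by blast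
    define t where "t = norm (\<Sum>k=N..<n. a k *\<^sub>R x k)"
    have "t \<noteq> 0" using a(2) unfolding t_def by auto
    then have t: "t > 0" unfolding t_def by simp
    have "N < n" using t by (cases "N < n") (auto simp: t_def)
    have "P j N n (\<lambda>k. inverse t * a k)"
      unfolding P_def sum_scaleR_factor using a t by (simp add: field_simps flip: t_def)
    then show "\<exists>n>N. \<exists>a. P j N n a" using \<open>N < n\<close> by blast
  next
    fix j N n and a b :: "nat \<Rightarrow> real"
    assume P: "P j N n a" and "\<And>k. N \<le> k \<Longrightarrow> k < n \<Longrightarrow> a k = b k"
    then have eq: "\<And>k. k \<in> {N..<n} \<Longrightarrow> a k = b k" by simp
    have "(\<Sum>k=N..<n. a k *\<^sub>R x k) = (\<Sum>k=N..<n. b k *\<^sub>R x k)"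
      "(\<Sum>k=N..<n. a k *\<^sub>R T (pprt (x k))) = (\<Sum>k=N..<n. b k *\<^sub>R T (pprt (x k)))"
      by (rule sum_scaleR_cong, erule eq)+
    then show "P j N n b" using P eq unfolding P_def by simp
  qed
  then obtain N a where N: "strict_mono N" and P: "\<And>j. P j (N j) (N (Suc j)) a" by blast
  define z where "z = (\<lambda>j. \<Sum>k=N j..<N (Suc j). a k *\<^sub>R x k)"
  have pz: "T (pprt (z j)) = (\<Sum>k=N j..<N (Suc j). a k *\<^sub>R T (pprt (x k)))" for j
  proof -
    have "pprt (z j) = (\<Sum>k=N j..<N (Suc j). pprt (a k *\<^sub>R x k))"
      unfolding z_def by (rule pprt_sum_disjoint)
        (auto intro!: disjoint_vec_scaleR disjoint_vec_commute[OF disjoint_vec_scaleR] x)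
    also have "\<dots> = (\<Sum>k=N j..<N (Suc j). a k *\<^sub>R pprt (x k))"
      using P[of j] by (intro sum.cong) (auto simp: P_def pprt_scaleR)
    finally show ?thesis by (simp add: T.sum T.scaleR)
  qed
  have disj: "disjoint_vec (z i) (z j)" if "i < j" for i j
    unfolding z_def
  proof (intro disjoint_vec_sum disjoint_vec_commute[OF disjoint_vec_sum])
    fix k l assume "k \<in> {N j..<N (Suc j)}" "l \<in> {N i..<N (Suc i)}"
    moreover have "N (Suc i) \<le> N j" using that strict_mono_less_eq[OF N] by simp
    ultimately have "k \<noteq> l" by simp
    then show "disjoint_vec (a k *\<^sub>R x k) (a l *\<^sub>R x l)"
      by (intro disjoint_vec_scaleR disjoint_vec_commute[OF disjoint_vec_scaleR] x) simp
  qed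
  show ?thesis
  proof (rule not_LSS_if_positive_parts_small[OF T _ _ c(1)])
    show "norm (z j) = 1" for j using P[of j] by (simp add: P_def z_def)
    show "disjoint_vec (z m) (z n)" if "m \<noteq> n" for m n
      using disj[of m n] disj[of n m] that disjoint_vec_commute by (cases "m < n") auto
    have "range z \<subseteq> span (range x)"
      unfolding z_def by (intro image_subsetI span_sum span_scale span_base rangeI)
    then have "span (range z) \<subseteq> span (range x)" by (rule span_minimal) simp
    then show "c * norm v \<le> norm (T v)" if "v \<in> span (range z)" for v using that c(2) by blast
    show "norm (T (pprt (z j))) \<le> c / 4 * (1 / 2) ^ j" for j using P[of j] by (simp add: P_def pz)
  qed
qed

text \<open>Either \<open>T\<close> is bounded below on the positive parts of some tail of \<open>x\<close>, or there are successive
  normalised blocks of the \<open>x k\<close> along which the blocks of the \<open>T (x k)\<^sup>+\<close> are as small as desired.  By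
  unconditionality the latter stay small when the coefficients are replaced by their moduli, while
  the norms of the blocks of \<open>x\<close> do not change, by disjointness.  This produces nonnegative coefficients.\<close>

lemma not_LSS_if_unconditional_positive_parts:
  fixes T :: "'a::banach_lattice \<Rightarrow> 'b::banach" and x :: "nat \<Rightarrow> 'a"
  assumes T: "bounded_linear T" and x: "\<And>m n. m \<noteq> n \<Longrightarrow> disjoint_vec (x m) (x n)"
    and c: "c > 0" "\<And>v. v \<in> span (range x) \<Longrightarrow> c * norm v \<le> norm (T v)"
    and u: "unconditional_basic_sequence (\<lambda>n. T (pprt (x n)))"
  shows "\<not> LSS T"
proof (cases "\<exists>M d. d > 0 \<and> (\<forall>a n. d * norm (\<Sum>k=M..<n. a k *\<^sub>R pprt (x k)) \<le> norm (\<Sum>k=M..<n. a k *\<^sub>R T (pprt (x k))))")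
  case True
  then obtain M d where d: "d > 0"
    "\<And>a n. d * norm (\<Sum>k=M..<n. a k *\<^sub>R pprt (x k)) \<le> norm (\<Sum>k=M..<n. a k *\<^sub>R T (pprt (x k)))" by blast
  show ?thesis
  proof (rule not_LSS_if_lower_bound[OF T, of "\<lambda>n. pprt (x (n + M))" d])
    show "pprt (x (n + M)) \<noteq> 0" for n
      using basic_sequence_nonzero[of "\<lambda>n. T (pprt (x n))" "n + M"] u T
      by (auto simp: unconditional_basic_sequence_def linear_simps)
    show "disjoint_vec (pprt (x (m + M))) (pprt (x (n + M)))" if "m \<noteq> n" for m n
      using that by (intro disjoint_vec_pprt x) simp
    fix a and n :: nat
    show "d * norm (\<Sum>k<n. a k *\<^sub>R pprt (x (k + M))) \<le> norm (\<Sum>k<n. a k *\<^sub>R T (pprt (x (k + M))))"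
      using d(2)[where a = "\<lambda>k. a (k - M)" and n = "n + M"]
      by (simp only: sum_scaleR_shift[of _ "\<lambda>k. pprt (x k)"] sum_scaleR_shift[of _ "\<lambda>k. T (pprt (x k))"])
  qed (use d in auto)
next
  case False
  define u where "u = (\<lambda>n. T (pprt (x n)))"
  define P where "P = (\<lambda>j N n a. norm (\<Sum>k=N..<n. a k *\<^sub>R x k) = 1 \<and>
    norm (\<Sum>k=N..<n. a k *\<^sub>R u k) \<le> (1 / 2) ^ (j::nat))"
  have blocks: "\<exists>N a. strict_mono N \<and> N 0 = N0 \<and> (\<forall>j. P j (N j) (N (Suc j)) a)" for N0
  proof (rule successive_blocks)
    fix j N :: nat
    have "(1 / 2 :: real) ^ j > 0" by simp
    then obtain a n where a: "norm (\<Sum>k=N..<n. a k *\<^sub>R u k) < (1 / 2) ^ j * norm (\<Sum>k=N..<n. a k *\<^sub>R pprt (x k))"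
      using False unfolding u_def by (meson not_le)
    define t where "t = norm (\<Sum>k=N..<n. a k *\<^sub>R x k)"
    have "norm (\<Sum>k=N..<n. a k *\<^sub>R pprt (x k)) \<le> t"
      unfolding t_def using x abs_pprt_le by (intro norm_sum_mono_disjoint) auto
    then have "(1 / 2) ^ j * norm (\<Sum>k=N..<n. a k *\<^sub>R pprt (x k)) \<le> (1 / 2) ^ j * t"
      by (intro mult_left_mono) auto
    then have at: "norm (\<Sum>k=N..<n. a k *\<^sub>R u k) < (1 / 2) ^ j * t" using a by linarith
    then have "t \<noteq> 0" by auto
    then have t: "t > 0" unfolding t_def by simp
    have "N < n" using t by (cases "N < n") (auto simp: t_def)
    have "P j N n (\<lambda>k. inverse t * a k)"
      unfolding P_def sum_scaleR_factor using at t by (simp add: field_simps flip: t_def)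
    then show "\<exists>n>N. \<exists>a. P j N n a" using \<open>N < n\<close> by blast
  next
    fix j N n and a b :: "nat \<Rightarrow> real"
    assume P: "P j N n a" and "\<And>k. N \<le> k \<Longrightarrow> k < n \<Longrightarrow> a k = b k"
    then have eq: "\<And>k. k \<in> {N..<n} \<Longrightarrow> a k = b k" by simp
    have "(\<Sum>k=N..<n. a k *\<^sub>R x k) = (\<Sum>k=N..<n. b k *\<^sub>R x k)"
      "(\<Sum>k=N..<n. a k *\<^sub>R u k) = (\<Sum>k=N..<n. b k *\<^sub>R u k)"
      by (rule sum_scaleR_cong, erule eq)+
    then show "P j N n b" using P unfolding P_def by simp
  qed
  show ?thesis
  proof (rule not_LSS_if_small_on_positive_combinations[OF T x c])
    fix N0 :: nat and e :: real assume e: "e > 0"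
    obtain N a where N: "strict_mono N" "N 0 = N0" and P: "\<And>j. P j (N j) (N (Suc j)) a"
      using blocks[of N0] by blast
    have "summable (\<lambda>j. norm (\<Sum>k=N j..<N (Suc j). a k *\<^sub>R u k))"
      by (rule summable_comparison_test'[OF summable_geometric[of "1 / 2 :: real"]])
        (use P in \<open>simp_all add: P_def\<close>)
    then have "(\<lambda>j. \<Sum>k=N j..<N (Suc j). \<bar>a k\<bar> *\<^sub>R u k) \<longlonglongrightarrow> 0"
      using \<open>unconditional_basic_sequence _\<close> N(1) unfolding u_def[symmetric]
      by (intro unconditional_blocks_abs_tendsto_zero)
    from LIMSEQ_D[OF this e] obtain j
      where "\<forall>i\<ge>j. norm ((\<Sum>k=N i..<N (Suc i). \<bar>a k\<bar> *\<^sub>R u k) - 0) < e" ..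
    then have j: "norm (\<Sum>k=N j..<N (Suc j). \<bar>a k\<bar> *\<^sub>R u k) < e" by simp
    let ?b = "\<lambda>k. if k < N j then 0 else \<bar>a k\<bar>"
    have N0j: "N0 \<le> N j" using N strict_mono_less_eq[OF N(1), of 0 j] by simp
    have "1 = norm (\<Sum>k=N j..<N (Suc j). a k *\<^sub>R x k)" using P[of j] by (simp add: P_def)
    also have "\<dots> \<le> norm (\<Sum>k=N j..<N (Suc j). \<bar>a k\<bar> *\<^sub>R x k)"
      using x by (intro norm_sum_mono_disjoint) auto
    finally have "e * 1 \<le> e * norm (\<Sum>k=N j..<N (Suc j). \<bar>a k\<bar> *\<^sub>R x k)"
      using e by (intro mult_left_mono) auto
    then have "norm (\<Sum>k=N0..<N (Suc j). ?b k *\<^sub>R u k) < e * norm (\<Sum>k=N0..<N (Suc j). ?b k *\<^sub>R x k)"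
      unfolding sum_scaleR_cut[OF N0j] using j by simp
    then show "\<exists>n b. (\<forall>k. 0 \<le> b k) \<and>
        norm (\<Sum>k=N0..<n. b k *\<^sub>R T (pprt (x k))) < e * norm (\<Sum>k=N0..<n. b k *\<^sub>R x k)"
      unfolding u_def by (intro exI[of _ "N (Suc j)"] exI[of _ ?b]) auto
  qed
qed

text \<open>If the norms of \<open>T (x n)\<^sup>+\<close> come arbitrarily close to \<open>0\<close> infinitely often, single vectors serve as
  blocks.  Otherwise a tail of \<open>T (x n)\<^sup>+\<close> is seminormalized and weakly null, and the unconditional
  subsequence property applies.\<close>

lemma not_LSS_if_weakly_null_positive_parts:
  fixes T :: "'a::banach_lattice \<Rightarrow> 'b::banach" and x :: "nat \<Rightarrow> 'a"
  assumes usp: "USP TYPE('b)" and T: "bounded_linear T"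
    and x: "\<And>m n. m \<noteq> n \<Longrightarrow> disjoint_vec (x m) (x n)" "\<And>n. norm (x n) = 1"
    and c: "c > 0" "\<And>v. v \<in> span (range x) \<Longrightarrow> c * norm v \<le> norm (T v)"
    and null: "weakly_null (\<lambda>n. pprt (x n))"
  shows "\<not> LSS T"
proof (cases "\<forall>N. \<forall>e>0. \<exists>n\<ge>N. norm (T (pprt (x n))) < e")
  case True
  show ?thesis
  proof (rule not_LSS_if_small_on_positive_combinations[OF T x(1) c])
    fix N :: nat and e :: real assume "e > 0"
    then obtain n where n: "n \<ge> N" "norm (T (pprt (x n))) < e" using True by blast
    let ?a = "\<lambda>k. if k = n then 1 else 0 :: real"
    show "\<exists>n a. (\<forall>k. 0 \<le> a k) \<and> norm (\<Sum>k=N..<n. a k *\<^sub>R T (pprt (x k))) < e * norm (\<Sum>k=N..<n. a k *\<^sub>R x k)"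
      by (intro exI[of _ "Suc n"] exI[of _ ?a]) (simp only: sum_scaleR_single[OF n(1)], use n x in simp)
  qed
next
  case False
  then obtain N e where e: "e > 0" "\<And>n. n \<ge> N \<Longrightarrow> e \<le> norm (T (pprt (x n)))" by (meson not_le)
  define y where "y = (\<lambda>n. T (pprt (x (n + N))))"
  obtain K where K: "\<And>v. norm (T v) \<le> norm v * K" "K > 0" using bounded_linear.pos_bounded[OF T] by blast
  have "norm (y n) \<le> K" for n
  proof -
    have "norm (pprt (x (n + N))) \<le> 1" using norm_lattice_mono[OF abs_pprt_le[of "x (n + N)"]] x(2) by simp
    then have "norm (pprt (x (n + N))) * K \<le> 1 * K" using K(2) by (intro mult_right_mono) auto
    then show ?thesis using K(1)[of "pprt (x (n + N))"] unfolding y_def by linarith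
  qed
  then have "seminormalized y"
    unfolding seminormalized_def using e by (intro exI[of _ e] exI[of _ K]) (simp add: y_def)
  moreover have "weakly_null y"
    unfolding weakly_null_def
  proof (intro allI impI)
    fix f :: "'b \<Rightarrow> real" assume "bounded_linear f"
    then have "bounded_linear (\<lambda>v. f (T v))" using T by (rule bounded_linear_compose)
    then have "(\<lambda>n. f (T (pprt (x n)))) \<longlonglongrightarrow> 0" using null unfolding weakly_null_def by blast
    then show "(\<lambda>n. f (y n)) \<longlonglongrightarrow> 0" unfolding y_def by (rule LIMSEQ_ignore_initial_segment)
  qed
  ultimately obtain r where r: "strict_mono r" "unconditional_basic_sequence (y \<circ> r)"
    using usp unfolding USP_def by blast
  show ?thesis
  proof (rule not_LSS_if_unconditional_positive_parts[OF T _ c(1)])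
    show "disjoint_vec (x (r m + N)) (x (r n + N))" if "m \<noteq> n" for m n
      using that r(1) by (intro x(1)) (simp add: strict_mono_eq)
    have "span (range (\<lambda>n. x (r n + N))) \<subseteq> span (range x)" by (intro span_mono) auto
    then show "c * norm v \<le> norm (T v)" if "v \<in> span (range (\<lambda>n. x (r n + N)))" for v
      using that c(2) by blast
    show "unconditional_basic_sequence (\<lambda>n. T (pprt (x (r n + N))))"
      using r(2) by (simp add: y_def o_def)
  qed
qed

text \<open>The functional \<open>f\<close> forces \<open>x\<close>, and by the lower bound for \<open>T\<close> also the sequence \<open>T (x n)\<close>, to be equivalent to
  the unit basis of \<open>\<ell>\<^sub>1\<close>, as well as all subsequences.  By Rosenthal's theorem, the images of the
  positive parts contain an \<open>\<ell>\<^sub>1\<close>-sequence or a weakly Cauchy sequence, and the same holds for the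
  negative parts.  An \<open>\<ell>\<^sub>1\<close>-sequence of images makes \<open>T\<close> an isomorphism on a positive disjoint
  sequence.  If both are weakly Cauchy along a subsequence, so is \<open>T (x n)\<close>, which is impossible for
  an \<open>\<ell>\<^sub>1\<close>-sequence.\<close>

lemma not_LSS_if_l1_positive_parts:
  fixes T :: "'a::banach_lattice \<Rightarrow> 'b::banach" and x :: "nat \<Rightarrow> 'a"
  assumes T: "bounded_linear T"
    and x: "\<And>m n. m \<noteq> n \<Longrightarrow> disjoint_vec (x m) (x n)" "\<And>n. norm (x n) = 1"
    and c: "c > 0" "\<And>v. v \<in> span (range x) \<Longrightarrow> c * norm v \<le> norm (T v)"
    and f: "bounded_linear (f :: 'a \<Rightarrow> real)" and d: "d > 0" "\<And>n. d \<le> f (pprt (x n))"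
  shows "\<not> LSS T"
proof -
  interpret T: bounded_linear T by fact
  interpret f: bounded_linear f by fact
  obtain K where K: "\<And>v. norm (T v) \<le> norm v * K" "K > 0" using T.pos_bounded by blast
  obtain L where L: "\<And>v. norm (f v) \<le> norm v * L" "L > 0" using f.pos_bounded by blast
  have p1: "norm (pprt (x n)) \<le> 1" "norm (pprt (- x n)) \<le> 1" for n
    using norm_lattice_mono[OF abs_pprt_le[of "x n"]] norm_lattice_mono[OF abs_pprt_le[of "- x n"]] x(2) by auto
  have Tp: "norm (T (pprt (x n))) \<le> K" "norm (T (pprt (- x n))) \<le> K" for n
    using K(1)[of "pprt (x n)"] K(1)[of "pprt (- x n)"] mult_right_mono[OF p1(1)[of n], of K]
      mult_right_mono[OF p1(2)[of n], of K] K(2) by linarith+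
  have l1: "c * d / L * (\<Sum>k<n. \<bar>a k\<bar>) \<le> norm (\<Sum>k<n. a k *\<^sub>R T (x (s k)))"
    if s: "strict_mono s" for s :: "nat \<Rightarrow> nat" and a and n :: nat
  proof -
    let ?v = "\<Sum>k<n. a k *\<^sub>R x (s k)"
    have "d * (\<Sum>k<n. \<bar>a k\<bar>) \<le> (\<Sum>k<n. \<bar>a k\<bar> * f (pprt (x (s k))))"
      unfolding sum_distrib_left using d(2) by (intro sum_mono) (metis abs_ge_zero mult.commute mult_left_mono)
    also have "\<dots> = f (\<Sum>k<n. \<bar>a k\<bar> *\<^sub>R pprt (x (s k)))" by (simp add: f.sum f.scaleR)
    also have "\<dots> \<le> norm (\<Sum>k<n. \<bar>a k\<bar> *\<^sub>R pprt (x (s k))) * L" by (rule order_trans[OF abs_ge_self L(1)[unfolded real_norm_def]])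
    also have "\<dots> \<le> norm ?v * L"
    proof (intro mult_right_mono norm_sum_mono_disjoint)
      show "disjoint_vec (x (s m)) (x (s n))" if "m \<noteq> n" for m n
        using that s by (intro x(1)) (simp add: strict_mono_eq)
    qed (use L(2) abs_pprt_le in auto)
    finally have "c * d / L * (\<Sum>k<n. \<bar>a k\<bar>) \<le> c * norm ?v" using c(1) L(2) by (simp add: field_simps)
    also have "?v \<in> span (range x)" by (intro span_sum span_scale span_base) auto
    then have "c * norm ?v \<le> norm (T ?v)" by (rule c(2))
    finally show ?thesis by (simp add: T.sum T.scaleR)
  qed
  show ?thesis
  proof (rule ccontr)
    assume LSS: "\<not> \<not> LSS T"
    have Cauchy: "\<exists>r :: nat \<Rightarrow> nat. strict_mono r \<and> (\<forall>g :: 'b \<Rightarrow> real. bounded_linear g \<longrightarrow> convergent (\<lambda>n. g (T (y (r n)))))"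
      if y: "\<And>n. 0 \<le> y n" "\<And>n. norm (y n) \<le> 1" "\<And>m n. m \<noteq> n \<Longrightarrow> disjoint_vec (y m) (y n)" for y :: "nat \<Rightarrow> 'a"
    proof -
      have "norm (T (y n)) \<le> K" for n using K(1)[of "y n"] mult_right_mono[OF y(2)[of n], of K] K(2) by linarith
      from rosenthal_l1[of "\<lambda>n. T (y n)", OF this] obtain r :: "nat \<Rightarrow> nat" where r: "strict_mono r"
        and alt: "(\<forall>g :: 'b \<Rightarrow> real. bounded_linear g \<longrightarrow> convergent (\<lambda>n. g (T (y (r n))))) \<or>
          (\<exists>d>0. \<forall>a n. d * (\<Sum>k<n. \<bar>a k\<bar>) \<le> norm (\<Sum>k<n. a k *\<^sub>R T (y (r k))))" by (elim exE conjE)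
      have no_l1: "\<not> (\<exists>d>0. \<forall>a n. d * (\<Sum>k<n. \<bar>a k\<bar>) \<le> norm (\<Sum>k<n. a k *\<^sub>R T (y (r k))))"
      proof
        assume "\<exists>d>0. \<forall>a n. d * (\<Sum>k<n. \<bar>a k\<bar>) \<le> norm (\<Sum>k<n. a k *\<^sub>R T (y (r k)))"
        then obtain d where "d > 0" "\<And>a n. d * (\<Sum>k<n. \<bar>a k\<bar>) \<le> norm (\<Sum>k<n. a k *\<^sub>R T (y (r k)))" by blast
        moreover have "disjoint_vec (y (r m)) (y (r n))" if "m \<noteq> n" for m n
          using that r by (intro y(3)) (simp add: strict_mono_eq)
        ultimately have "\<not> LSS T"
          using y(1,2) by (intro not_LSS_if_l1_lower_bound[OF T, of "\<lambda>n. y (r n)" d]) auto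
        then show False using LSS by simp
      qed
      from alt have "\<forall>g :: 'b \<Rightarrow> real. bounded_linear g \<longrightarrow> convergent (\<lambda>n. g (T (y (r n))))"
        by (rule disjE) (assumption, rule notE[OF no_l1])
      then show ?thesis using r by (intro exI[of _ r] conjI)
    qed
    obtain r where r: "strict_mono r"
      and rc: "\<And>g :: 'b \<Rightarrow> real. bounded_linear g \<Longrightarrow> convergent (\<lambda>n. g (T (pprt (x (r n)))))"
      using Cauchy[of "\<lambda>n. pprt (x n)"] p1(1) disjoint_vec_pprt[OF x(1)] by auto
    have "disjoint_vec (pprt (- x (r m))) (pprt (- x (r n)))" if "m \<noteq> n" for m n
      using that r by (intro disjoint_vec_pprt disjoint_vec_uminus x(1)) (simp add: strict_mono_eq)
    then obtain s where s: "strict_mono s"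
      and sc: "\<And>g :: 'b \<Rightarrow> real. bounded_linear g \<Longrightarrow> convergent (\<lambda>n. g (T (pprt (- x (r (s n))))))"
      using Cauchy[of "\<lambda>n. pprt (- x (r n))"] p1(2) by auto
    have "convergent (\<lambda>n. g (T (x (r (s n)))))" if g: "bounded_linear g" for g :: "'b \<Rightarrow> real"
    proof -
      interpret g: bounded_linear g by fact
      have "convergent (\<lambda>n. g (T (pprt (x (r (s n))))))"
        using convergent_subseq_convergent[OF rc[OF g] s] by (simp add: o_def)
      then have "convergent (\<lambda>n. g (T (pprt (x (r (s n))))) - g (T (pprt (- x (r (s n))))))"
        using sc[OF g] by (rule convergent_diff)
      moreover have "g (T (x (r (s n)))) = g (T (pprt (x (r (s n))))) - g (T (pprt (- x (r (s n)))))" for n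
        by (metis T.diff g.diff pprt_minus_pprt_uminus)
      ultimately show ?thesis by simp
    qed
    note convergent_Tx = this
    have mono: "strict_mono (\<lambda>n. r (s n))" using r s by (simp add: strict_mono_def)
    have "c * d / L > 0" using c(1) d(1) L(2) by simp
    from l1_sequence_not_weakly_Cauchy[OF this l1[OF mono]]
    have "\<exists>g :: 'b \<Rightarrow> real. bounded_linear g \<and> \<not> convergent (\<lambda>n. g (T (x (r (s n)))))" .
    then show False using convergent_Tx by (elim exE conjE notE)
  qed
qed

text \<open>A functional that does not tend to \<open>0\<close> along the positive parts is bounded away from \<open>0\<close>, with constant
  sign after replacing it by its negative if necessary, on a subsequence; so one of the two
  preceding cases applies.\<close>

theorem LSS_imp_DSS:
  fixes T :: "'a::banach_lattice \<Rightarrow> 'b::banach"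
  assumes usp: "USP TYPE('b)" and T: "bounded_linear T" and LSS: "LSS T"
  shows "DSS T"
  unfolding DSS_def
proof (rule notI, elim exE conjE)
  fix x0 :: "nat \<Rightarrow> 'a"
  assume x0: "\<forall>n. x0 n \<noteq> 0" "\<forall>m n. m \<noteq> n \<longrightarrow> disjoint_vec (x0 m) (x0 n)" and iso: "iso_onto_image (closed_span x0) T"
  obtain c where c: "c > 0" "\<And>v. v \<in> closed_span x0 \<Longrightarrow> c * norm v \<le> norm (T v)"
    using iso_onto_image_lower_bound[OF T subspace_closed_span iso] by blast
  define x where "x = (\<lambda>n. inverse (norm (x0 n)) *\<^sub>R x0 n)"
  have x: "disjoint_vec (x m) (x n)" if "m \<noteq> n" for m n
    unfolding x_def using x0(2) that by (intro disjoint_vec_scaleR disjoint_vec_commute[OF disjoint_vec_scaleR]) auto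
  have x1: "norm (x n) = 1" for n using x0(1) by (simp add: x_def)
  have "span (range x) \<subseteq> span (range x0)"
    by (rule span_minimal) (auto simp: x_def intro!: span_scale intro: span_base)
  also have "\<dots> \<subseteq> closed_span x0" unfolding closed_span_def by (rule closure_subset)
  finally have lower: "c * norm v \<le> norm (T v)" if "v \<in> span (range x)" for v using that c(2) by blast
  show False
  proof (cases "weakly_null (\<lambda>n. pprt (x n))")
    case True
    have "\<not> LSS T" by (rule not_LSS_if_weakly_null_positive_parts[OF usp T x x1 c(1) lower True])
    then show False using LSS by simp
  next
    case False
    then obtain f0 :: "'a \<Rightarrow> real" where f0: "bounded_linear f0" "\<not> (\<lambda>n. f0 (pprt (x n))) \<longlonglongrightarrow> 0"
      by (auto simp: weakly_null_def)
    then obtain d where d: "d > 0" "\<And>N. \<exists>n\<ge>N. d \<le> \<bar>f0 (pprt (x n))\<bar>"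
      unfolding LIMSEQ_iff by (auto simp: not_less)
    then have "infinite {n. d \<le> \<bar>f0 (pprt (x n))\<bar>}"
      unfolding infinite_nat_iff_unbounded_le by blast
    moreover have "{n. d \<le> \<bar>f0 (pprt (x n))\<bar>} \<subseteq> {n. d \<le> f0 (pprt (x n))} \<union> {n. d \<le> - f0 (pprt (x n))}" by auto
    ultimately have "infinite {n. d \<le> f0 (pprt (x n))} \<or> infinite {n. d \<le> - f0 (pprt (x n))}"
      using finite_subset by blast
    then obtain f :: "'a \<Rightarrow> real" where f: "bounded_linear f" "infinite {n. d \<le> f (pprt (x n))}"
      using f0(1) bounded_linear_minus[OF f0(1)] by blast
    define r where "r = enumerate {n. d \<le> f (pprt (x n))}"
    have r: "strict_mono r" "d \<le> f (pprt (x (r n)))" for n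
      using f(2) enumerate_in_set[OF f(2), of n] by (auto simp: r_def strict_mono_enumerate)
    have "\<not> LSS T"
    proof (rule not_LSS_if_l1_positive_parts[OF T _ _ c(1) _ f(1) d(1)])
      show "disjoint_vec (x (r m)) (x (r n))" if "m \<noteq> n" for m n
        using that r(1) by (intro x) (simp add: strict_mono_eq)
      have "span (range (\<lambda>n. x (r n))) \<subseteq> span (range x)" by (intro span_mono) auto
      then show "c * norm v \<le> norm (T v)" if "v \<in> span (range (\<lambda>n. x (r n)))" for v
        using that lower by blast
    qed (use x1 r in auto)
    then show False using LSS by simp
  qed
qed

theorem theorem2p3:
  fixes T :: "'a::banach_lattice \<Rightarrow> 'b::banach"
  assumes "USP TYPE('b)" and "bounded_linear T"
  shows "LSS T \<longleftrightarrow> DSS T"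
  using LSS_imp_DSS[OF assms] DSS_imp_LSS[OF assms(2)] by blast

end
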